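(* Let $(X_n)_{n\geq 1}$ be independent standard Gaussian random variables and let $F(\sigma)=\sum_{n=1}^\infty X_n n^{-\sigma}$ for real $\sigma>1/2$. For $T>1/2$ let $N(T,\infty)$ denote the number of real zeros of $F$ in $[T,\infty)$, each counted without multiplicity. Then almost surely $$\limsup_{T\to1/2^+}\frac{N(T,\infty)}{\log\left(\frac{1}{T-1/2}\right)\log\log\left(\frac{1}{T-1/2}\right)}<\infty,$$ and for every $\epsilon>0$, almost surely $$\liminf_{T\to1/2^+}\frac{N(T,\infty)}{\left(\log\left(\frac{1}{T-1/2}\right)\right)^{1/2-\epsilon}}=\infty.$$ *)

theory Defs
  imports "HOL-Probability.Probability"
begin

text \<open>
  The coefficients are indexed by \<open>n \<ge> 1\<close>, so the \<open>k\<close>-th summand (\<open>k \<ge> 0\<close>) below is the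
  term of index \<open>n = Suc k\<close>. The value is the limit of the ordered partial sums, since the series is
  in general only conditionally convergent. Where the series diverges, \<^const>\<open>suminf\<close> has an
  unspecified value; for independent standard Gaussian coefficients, almost surely the series
  converges for all \<open>\<sigma> > 1/2\<close> simultaneously.
\<close>

definition dirichlet_series :: "(nat \<Rightarrow> real) \<Rightarrow> real \<Rightarrow> real" where
  "dirichlet_series x \<sigma> = (\<Sum>k. x (Suc k) * real (Suc k) powr (- \<sigma>))"

text \<open>
  The count is extended-real valued, because \<^const>\<open>card\<close> is \<open>0\<close> on infinite sets.
\<close>

definition num_zeros_from :: "(real \<Rightarrow> real) \<Rightarrow> real \<Rightarrow> ereal" where
  "num_zeros_from f T =
     (if finite {\<sigma>. T \<le> \<sigma> \<and> f \<sigma> = 0}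
      then ereal (real (card {\<sigma>. T \<le> \<sigma> \<and> f \<sigma> = 0})) else \<infinity>)"

end

theory Submission
  imports Defs "HOL-Complex_Analysis.Complex_Analysis" "HOL-Real_Asymp.Real_Asymp"
begin

text \<open>
  Almost surely the partial sums of the coefficients are \<open>O(n\<^sup>1\<^sup>/\<^sup>2\<^sup>+\<^sup>\<epsilon>)\<close>, so by Abel summation the series
  extends to a holomorphic function \<open>F\<close> on \<open>Re z > 1/2\<close>.

  Upper bound. Cover \<open>(1/2, 3/2]\<close> by intervals of radius \<open>\<delta>/24\<close> centred at \<open>c = 1/2 + \<delta>\<close> with
  \<open>\<delta> = (15/16)^k\<close>; about \<open>log (1 / (T - 1/2))\<close> of them meet \<open>[T, 3/2]\<close>. The variance of \<open>F(c)\<close> is of order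
  \<open>1/\<delta>\<close>, and the normalised Taylor coefficients \<open>F\<^sup>(\<^sup>j\<^sup>)(c) \<delta>^j / j!\<close> have variance at most
  \<open>4^j (1 + 1/\<delta>)\<close>. By Borel-Cantelli, for large \<open>k\<close> the ratio of the maximum of \<open>F\<close> near \<open>c\<close> to \<open>F(c)\<close> is
  at most a power of \<open>k\<close>, and dividing out the zeros leaves only \<open>O(log k)\<close> of them in the \<open>k\<close>-th interval.

  Lower bound. At \<open>1/2 + 2^(-k^2)\<close> the value of \<open>F\<close> is dominated by the terms with index in a block
  \<open>u\<^sub>k \<le> n < u\<^sub>k\<^sub>+\<^sub>1\<close>, \<open>u\<^sub>k = 2^(2^(k^2 - k))\<close>: the remaining terms carry a fraction \<open>O(2^(-k))\<close> of
  the variance. The block sums are independent, so by Hoeffding's inequality a positive proportion of consecutive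
  pairs of them shows a sign change that the remainder cannot undo. This gives order
  \<open>(log (1 / (T - 1/2)))\<^sup>1\<^sup>/\<^sup>2\<close> zeros.
\<close>

section \<open>Gaussian sums\<close>

text \<open>The event is the increasing union of the sets \<open>A n\<close> on which every
  \<open>E k\<close> with \<open>k \<ge> n\<close> occurs. Each \<open>A n\<close> lies in one
  \<open>E k\<close> with \<open>k \<ge> n0\<close>, and continuity from below carries the bound
  over to the union.\<close>

lemma (in prob_space) prob_eventually_le:
  assumes E [measurable]: "\<And>n. E n \<in> events" and le: "\<And>n. n \<ge> n0 \<Longrightarrow> prob (E n) \<le> p"
  shows "prob {\<omega>\<in>space M. eventually (\<lambda>n. \<omega> \<in> E n) sequentially} \<le> p"
proof -
  define A where "A n = {\<omega>\<in>space M. \<forall>k\<ge>n. \<omega> \<in> E k}" for n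
  have [measurable]: "A n \<in> events" for n
    unfolding A_def by measurable
  have "incseq A"
    by (auto simp: incseq_def A_def)
  then have "(\<lambda>n. prob (A n)) \<longlonglongrightarrow> prob (\<Union>n. A n)"
    by (intro finite_Lim_measure_incseq) auto
  moreover have "prob (A n) \<le> p" for n
  proof -
    have "prob (A n) \<le> prob (E (max n n0))"
      by (intro finite_measure_mono) (auto simp: A_def)
    with le show ?thesis
      by (meson max.cobounded2 order_trans)
  qed
  ultimately have "prob (\<Union>n. A n) \<le> p"
    by (intro LIMSEQ_le_const2) auto
  moreover have "(\<Union>n. A n) = {\<omega>\<in>space M. eventually (\<lambda>n. \<omega> \<in> E n) sequentially}"
    by (auto simp: A_def eventually_sequentially)
  ultimately show ?thesis
    by simp
qed

lemma std_normal_density_le_half: "std_normal_density x \<le> 1 / 2"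
proof -
  have "2 \<le> sqrt (2 * pi)"
    using pi_gt3 by (intro real_le_rsqrt) auto
  then have "1 / sqrt (2 * pi) \<le> 1 / 2"
    by (intro divide_left_mono) auto
  moreover have "exp (- x\<^sup>2 / 2) \<le> 1"
    by simp
  ultimately have "1 / sqrt (2 * pi) * exp (- x\<^sup>2 / 2) \<le> 1 / 2 * 1"
    by (intro mult_mono) auto
  then show ?thesis
    by (simp add: std_normal_density_def)
qed

section \<open>Small balls and tails of a single Gaussian\<close>

context prob_space
begin

lemma std_normal_small_ball:
  assumes Z: "distributed M lborel Z std_normal_density" and "t > 0"
  shows "prob {\<omega>\<in>space M. \<bar>Z \<omega>\<bar> < t} \<le> t"
proof -
  have "emeasure M (Z -` {-t<..<t} \<inter> space M)
      = (\<integral>\<^sup>+x. ennreal (std_normal_density x) * indicator {-t<..<t} x \<partial>lborel)"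
    by (rule distributed_emeasure[OF Z]) simp
  also have "\<dots> \<le> (\<integral>\<^sup>+x. ennreal (1/2) * indicator {-t<..<t} x \<partial>lborel)"
    by (intro nn_integral_mono mult_right_mono ennreal_leI std_normal_density_le_half) auto
  also have "\<dots> = ennreal (1/2) * ennreal (2 * t)"
    using \<open>t > 0\<close> by (subst nn_integral_cmult_indicator) auto
  also have "\<dots> = ennreal (1/2 * (2 * t))"
    using \<open>t > 0\<close> by (intro ennreal_mult[symmetric]) auto
  also have "1/2 * (2 * t) = t"
    by simp
  finally have "emeasure M (Z -` {-t<..<t} \<inter> space M) \<le> ennreal t" .
  moreover have "Z -` {-t<..<t} \<inter> space M = {\<omega>\<in>space M. \<bar>Z \<omega>\<bar> < t}"
    by auto
  ultimately show ?thesis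
    using \<open>t > 0\<close> by (simp add: emeasure_eq_measure)
qed

text \<open>Markov's inequality for the moment of order \<open>2 * k\<close>, whose value is the
  double factorial (2k-1)!!. The case \<open>k = 1\<close> is Chebyshev's inequality; large
  \<open>k\<close> gives arbitrarily fast polynomial decay.\<close>

lemma std_normal_tail:
  assumes Z: "distributed M lborel Z std_normal_density" and "t > 0"
  shows "prob {\<omega>\<in>space M. t \<le> \<bar>Z \<omega>\<bar>} \<le> fact (2 * k) / (2 ^ k * fact k) / t ^ (2 * k)"
proof -
  have [measurable]: "Z \<in> borel_measurable M"
    using Z by (simp add: distributed_def)
  have int: "integrable M (\<lambda>\<omega>. Z \<omega> ^ (2 * k))"
    using std_normal_moment_even[of k]
    by (subst distributed_integrable[OF Z, symmetric]) (auto simp: has_bochner_integral_iff)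
  have eq: "(\<integral>\<omega>. Z \<omega> ^ (2 * k) \<partial>M) = fact (2 * k) / (2 ^ k * fact k)"
    using integral_std_normal_moment_even[of k]
    by (subst distributed_integral[OF Z, symmetric]) auto
  have "prob {\<omega>\<in>space M. t \<le> \<bar>Z \<omega>\<bar>} \<le> prob {\<omega>\<in>space M. t ^ (2 * k) \<le> Z \<omega> ^ (2 * k)}"
  proof (intro finite_measure_mono subsetI)
    fix \<omega> assume "\<omega> \<in> {\<omega> \<in> space M. t \<le> \<bar>Z \<omega>\<bar>}"
    then have "\<omega> \<in> space M" "t ^ (2 * k) \<le> \<bar>Z \<omega>\<bar> ^ (2 * k)"
      using \<open>t > 0\<close> by (auto intro!: power_mono)
    then show "\<omega> \<in> {\<omega>\<in>space M. t ^ (2 * k) \<le> Z \<omega> ^ (2 * k)}"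
      by (simp add: power_even_abs)
  qed measurable
  also have "\<dots> \<le> (\<integral>\<omega>. Z \<omega> ^ (2 * k) \<partial>M) / t ^ (2 * k)"
    using \<open>t > 0\<close> by (intro integral_Markov_inequality_measure[OF int, where A="{}"]) auto
  finally show ?thesis
    by (simp add: eq)
qed

end

text \<open>Only the positivity of this constant matters. It is the probability that a centred
  Gaussian exceeds its own standard deviation.\<close>

definition std_normal_upper_tail :: real where
  "std_normal_upper_tail = measure (density lborel std_normal_density) {1<..}"

lemma (in prob_space) prob_std_normal_gt_1:
  assumes Z: "distributed M lborel Z std_normal_density"
  shows "prob {\<omega>\<in>space M. 1 < Z \<omega>} = std_normal_upper_tail"
proof -
  have [measurable]: "Z \<in> borel_measurable M"
    using Z by (simp add: distributed_def)
  have "std_normal_upper_tail = measure (distr M lborel Z) {1<..}"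
    by (simp add: std_normal_upper_tail_def distributed_distr_eq_density[OF Z])
  also have "\<dots> = prob (Z -` {1<..} \<inter> space M)"
    by (subst measure_distr) auto
  also have "Z -` {1<..} \<inter> space M = {\<omega>\<in>space M. 1 < Z \<omega>}"
    by auto
  finally show ?thesis ..
qed

lemma (in prob_space) prob_std_normal_lt_m1:
  assumes Z: "distributed M lborel Z std_normal_density"
  shows "prob {\<omega>\<in>space M. Z \<omega> < -1} = std_normal_upper_tail"
proof -
  have "distributed M lborel (\<lambda>\<omega>. - Z \<omega>) std_normal_density"
    using normal_density_affine[of Z 0 1 "-1" 0] Z by simp
  from prob_std_normal_gt_1[OF this] show ?thesis
    by (simp add: less_minus_iff[of 1])
qed

text \<open>On the interval (1, 2), of length 1, the density is at least its value at 2.\<close>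

lemma std_normal_upper_tail_pos: "std_normal_upper_tail > 0"
proof -
  let ?D = "density lborel (\<lambda>x. ennreal (std_normal_density x))"
  interpret D: prob_space ?D
    using prob_space_normal_density[of 1 0] by simp
  have "0 < ennreal (std_normal_density 2)"
    by (simp add: std_normal_density_def)
  also have "\<dots> = (\<integral>\<^sup>+x. ennreal (std_normal_density 2) * indicator {1<..<2::real} x \<partial>lborel)"
    by (subst nn_integral_cmult_indicator) auto
  also have "\<dots> \<le> (\<integral>\<^sup>+x. ennreal (std_normal_density x) * indicator {1<..} x \<partial>lborel)"
  proof (intro nn_integral_mono)
    fix x :: real
    have "std_normal_density 2 \<le> std_normal_density x" if "x \<in> {1<..<2}"
    proof -
      have "x\<^sup>2 \<le> 2\<^sup>2"
        using that by (intro power_mono) auto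
      then show ?thesis
        by (simp add: std_normal_density_def divide_right_mono)
    qed
    then show "ennreal (std_normal_density 2) * indicator {1<..<2} x
        \<le> ennreal (std_normal_density x) * indicator {1<..} x"
      by (auto simp: indicator_def intro!: ennreal_leI)
  qed
  also have "\<dots> = emeasure ?D {1<..}"
    by (subst emeasure_density) auto
  finally show ?thesis
    by (simp add: std_normal_upper_tail_def D.emeasure_eq_measure)
qed

text \<open>Indexing starts at 0: in the application \<open>\<xi> k\<close> is the coefficient of
  index \<open>Suc k\<close>, so it is paired with powers of \<open>Suc k\<close>.\<close>

locale iid_normal = prob_space M for M :: "'a measure" +
  fixes \<xi> :: "nat \<Rightarrow> 'a \<Rightarrow> real"
  assumes indep_\<xi>: "indep_vars (\<lambda>_. borel) \<xi> UNIV"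
    and distributed_\<xi>: "distributed M lborel (\<xi> n) std_normal_density"
begin

lemma measurable_\<xi> [measurable]: "\<xi> n \<in> borel_measurable M"
  using distributed_\<xi>[of n] by (simp add: distributed_def)

lemma distributed_weighted_sum:
  assumes "finite I" and pos: "(\<Sum>m\<in>I. (a m)\<^sup>2) > 0"
  shows "distributed M lborel (\<lambda>\<omega>. (\<Sum>m\<in>I. a m * \<xi> m \<omega>) / sqrt (\<Sum>m\<in>I. (a m)\<^sup>2)) std_normal_density"
proof -
  \<comment> \<open>\<open>sum_indep_normal\<close> asks for a nonempty index set and positive
    standard deviations, so zero weights are removed first.\<close>
  define J where "J = {m\<in>I. a m \<noteq> 0}"
  have J: "finite J" "J \<subseteq> I"
    using \<open>finite I\<close> by (auto simp: J_def)
  have sq: "(\<Sum>m\<in>J. (a m)\<^sup>2) = (\<Sum>m\<in>I. (a m)\<^sup>2)"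
    using \<open>finite I\<close> by (intro sum.mono_neutral_left) (auto simp: J_def)
  have s: "(\<Sum>m\<in>J. a m * \<xi> m \<omega>) = (\<Sum>m\<in>I. a m * \<xi> m \<omega>)" for \<omega>
    using \<open>finite I\<close> by (intro sum.mono_neutral_left) (auto simp: J_def)
  have "J \<noteq> {}"
    using pos sq by auto
  have "indep_vars (\<lambda>_. borel) (\<lambda>m \<omega>. a m * \<xi> m \<omega>) J"
    by (intro indep_vars_compose2[where Y="\<lambda>m x. a m * x", OF indep_vars_subset[OF indep_\<xi> subset_UNIV]]) simp
  moreover have "distributed M lborel (\<lambda>\<omega>. a m * \<xi> m \<omega>) (normal_density 0 \<bar>a m\<bar>)" if "m \<in> J" for m
    using normal_density_affine[of "\<xi> m" 0 1 "a m" 0] distributed_\<xi>[of m] that by (simp add: J_def)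
  ultimately have "distributed M lborel (\<lambda>\<omega>. \<Sum>m\<in>J. a m * \<xi> m \<omega>)
      (normal_density (\<Sum>m\<in>J. 0) (sqrt (\<Sum>m\<in>J. \<bar>a m\<bar>\<^sup>2)))"
    using J \<open>J \<noteq> {}\<close> by (intro sum_indep_normal) (auto simp: J_def)
  then have "distributed M lborel (\<lambda>\<omega>. \<Sum>m\<in>I. a m * \<xi> m \<omega>) (normal_density 0 (sqrt (\<Sum>m\<in>I. (a m)\<^sup>2)))"
    by (simp add: s sq)
  then show ?thesis
    using pos by (subst (asm) normal_standard_normal_convert) auto
qed

text \<open>Chebyshev's inequality, obtained from \<open>std_normal_tail\<close> with
  \<open>k = 1\<close> after normalisation. A sum of variance 0 cannot be normalised, but it
  vanishes identically and the event is empty.\<close>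

lemma prob_weighted_sum_gt:
  assumes "finite I" "(\<Sum>m\<in>I. (a m)\<^sup>2) \<le> V" "V > 0" "t > 0"
  shows "prob {\<omega>\<in>space M. t < \<bar>\<Sum>m\<in>I. a m * \<xi> m \<omega>\<bar>} \<le> V / t\<^sup>2"
proof (cases "(\<Sum>m\<in>I. (a m)\<^sup>2) = 0")
  case True
  then have "a m = 0" if "m \<in> I" for m
    using that \<open>finite I\<close> by (subst (asm) sum_nonneg_eq_0_iff) auto
  then have "(\<Sum>m\<in>I. a m * \<xi> m \<omega>) = 0" for \<omega>
    by simp
  then show ?thesis
    using assms by simp
next
  case False
  define v where "v = (\<Sum>m\<in>I. (a m)\<^sup>2)"
  have v: "v > 0" "v \<le> V"
    using False assms by (auto simp: v_def order_less_le sum_nonneg)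
  have "prob {\<omega>\<in>space M. t < \<bar>\<Sum>m\<in>I. a m * \<xi> m \<omega>\<bar>}
      \<le> prob {\<omega>\<in>space M. t / sqrt v \<le> \<bar>(\<Sum>m\<in>I. a m * \<xi> m \<omega>) / sqrt v\<bar>}"
    using v by (intro finite_measure_mono) (auto simp: divide_right_mono)
  also have "\<dots> \<le> fact (2 * 1) / (2 ^ 1 * fact 1) / (t / sqrt v) ^ (2 * 1)"
    using v \<open>t > 0\<close> unfolding v_def
    by (intro std_normal_tail distributed_weighted_sum assms) auto
  also have "\<dots> = v / t\<^sup>2"
    using v by (simp add: power_divide)
  also have "\<dots> \<le> V / t\<^sup>2"
    using v by (simp add: divide_right_mono)
  finally show ?thesis .
qed

text \<open>After division by the true standard deviation the small-ball bound applies; a larger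
  variance only makes the ball smaller.\<close>

lemma prob_weighted_sum_lt:
  assumes "finite I" "(\<Sum>m\<in>I. (a m)\<^sup>2) \<ge> v" "v > 0" "t > 0"
  shows "prob {\<omega>\<in>space M. \<bar>\<Sum>m\<in>I. a m * \<xi> m \<omega>\<bar> < t} \<le> t / sqrt v"
proof -
  define v' where "v' = (\<Sum>m\<in>I. (a m)\<^sup>2)"
  have v: "v' > 0" "v \<le> v'"
    using assms by (auto simp: v'_def)
  have "prob {\<omega>\<in>space M. \<bar>\<Sum>m\<in>I. a m * \<xi> m \<omega>\<bar> < t}
      \<le> prob {\<omega>\<in>space M. \<bar>(\<Sum>m\<in>I. a m * \<xi> m \<omega>) / sqrt v'\<bar> < t / sqrt v'}"
    using v by (intro finite_measure_mono) (auto simp: divide_strict_right_mono)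
  also have "\<dots> \<le> t / sqrt v'"
    using v \<open>t > 0\<close> unfolding v'_def
    by (intro std_normal_small_ball distributed_weighted_sum assms) auto
  also have "\<dots> \<le> t / sqrt v"
    using v \<open>t > 0\<close> \<open>v > 0\<close> by (intro divide_left_mono) auto
  finally show ?thesis .
qed

text \<open>Tail and small-ball bounds for the limit of the sums are stated as bounds on the event that the partial sums are
  eventually in an open set; this avoids measurability of the limit.\<close>

lemma prob_eventually_weighted_sum_gt:
  assumes "\<And>n. (\<Sum>m<n. (a m)\<^sup>2) \<le> V" "V > 0" "t > 0"
  shows "prob {\<omega>\<in>space M. eventually (\<lambda>n. t < \<bar>\<Sum>m<n. a m * \<xi> m \<omega>\<bar>) sequentially} \<le> V / t\<^sup>2"
proof -
  have "prob {\<omega>\<in>space M. eventually (\<lambda>n. \<omega> \<in> {\<omega>\<in>space M. t < \<bar>\<Sum>m<n. a m * \<xi> m \<omega>\<bar>}) sequentially}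
      \<le> V / t\<^sup>2"
    by (intro prob_eventually_le[where ?n0.0=0] prob_weighted_sum_gt assms) auto
  then show ?thesis
    by (simp cong: conj_cong)
qed

lemma prob_eventually_weighted_sum_lt:
  assumes "(\<Sum>m<n0. (a m)\<^sup>2) \<ge> v" "v > 0" "t > 0"
  shows "prob {\<omega>\<in>space M. eventually (\<lambda>n. \<bar>\<Sum>m<n. a m * \<xi> m \<omega>\<bar> < t) sequentially} \<le> t / sqrt v"
proof -
  have "(\<Sum>m<n. (a m)\<^sup>2) \<ge> v" if "n \<ge> n0" for n
  proof -
    have "(\<Sum>m<n0. (a m)\<^sup>2) \<le> (\<Sum>m<n. (a m)\<^sup>2)"
      using that by (intro sum_mono2) auto
    with assms show ?thesis
      by linarith
  qed
  then have "prob {\<omega>\<in>space M. eventually (\<lambda>n. \<omega> \<in> {\<omega>\<in>space M. \<bar>\<Sum>m<n. a m * \<xi> m \<omega>\<bar> < t}) sequentially}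
      \<le> t / sqrt v"
    by (intro prob_eventually_le[where ?n0.0=n0] prob_weighted_sum_lt assms) auto
  then show ?thesis
    by (simp cong: conj_cong)
qed

text \<open>The sum of \<open>n\<close> coefficients divided by \<open>sqrt n\<close> is standard
  normal. A moment of high enough order makes the exceptional probabilities O(1/n^2), and
  Borel-Cantelli applies.\<close>

lemma AE_partial_sums_powr:
  assumes "\<epsilon> > 0"
  shows "AE \<omega> in M. \<exists>C. \<forall>n. \<bar>\<Sum>k<n. \<xi> k \<omega>\<bar> \<le> C * real n powr (1/2 + \<epsilon>)"
proof -
  define p where "p = nat \<lceil>1 / \<epsilon>\<rceil>"
  have p: "real p * \<epsilon> \<ge> 1"
  proof -
    have "1 / \<epsilon> \<le> real p"
      by (simp add: p_def real_nat_ceiling_ge)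
    then show ?thesis
      using \<open>\<epsilon> > 0\<close> by (simp add: field_simps)
  qed
  define K :: real where "K = fact (2 * p) / (2 ^ p * fact p)"
  define E where "E n = {\<omega>\<in>space M. \<bar>\<Sum>k<n. \<xi> k \<omega>\<bar> > real n powr (1/2 + \<epsilon>)}" for n
  have [measurable]: "E n \<in> events" for n
    unfolding E_def by measurable
  have bound: "prob (E n) \<le> K * (1 / real n ^ 2)" if "n \<ge> 1" for n
  proof -
    have "prob (E n) \<le> prob {\<omega>\<in>space M. real n powr \<epsilon> \<le> \<bar>(\<Sum>k<n. 1 * \<xi> k \<omega>) / sqrt (\<Sum>k<n. 1\<^sup>2)\<bar>}"
    proof (intro finite_measure_mono subsetI)
      fix \<omega> assume "\<omega> \<in> E n"
      then have "\<omega> \<in> space M" "\<bar>\<Sum>k<n. \<xi> k \<omega>\<bar> \<ge> real n powr \<epsilon> * sqrt (real n)"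
        using that by (auto simp: E_def powr_add powr_half_sqrt mult.commute)
      then show "\<omega> \<in> {\<omega>\<in>space M. real n powr \<epsilon> \<le> \<bar>(\<Sum>k<n. 1 * \<xi> k \<omega>) / sqrt (\<Sum>k<n. 1\<^sup>2)\<bar>}"
        using that by (simp add: field_simps)
    qed measurable
    also have "\<dots> \<le> fact (2 * p) / (2 ^ p * fact p) / (real n powr \<epsilon>) ^ (2 * p)"
      using that by (intro std_normal_tail distributed_weighted_sum) auto
    also have "\<dots> \<le> K / real n ^ 2"
      unfolding K_def
    proof (intro divide_left_mono)
      have "real n ^ 2 = real n powr 2"
        using that by (simp add: powr_numeral)
      also have "\<dots> \<le> real n powr (\<epsilon> * real (2 * p))"
        using that p by (intro powr_mono) (auto simp: mult_ac)
      also have "\<dots> = (real n powr \<epsilon>) ^ (2 * p)"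
        using that by (simp add: powr_powr[symmetric] powr_realpow power_mult)
      finally show "real n ^ 2 \<le> (real n powr \<epsilon>) ^ (2 * p)" .
    qed (use that in auto)
    finally show ?thesis
      by simp
  qed
  have "summable (\<lambda>n. prob (E n))"
  proof (rule summable_comparison_test'[where N=1])
    show "summable (\<lambda>n. K * (1 / real n ^ 2))"
      by (intro summable_mult inverse_power_summable[of 2, where 'a=real, unfolded inverse_eq_divide]) auto
  qed (use bound in auto)
  then have "AE \<omega> in M. eventually (\<lambda>n. \<omega> \<in> space M - E n) sequentially"
    by (intro borel_cantelli_AE1) (auto simp: emeasure_eq_measure)
  then show ?thesis
  proof eventually_elim
    case (elim \<omega>)
    then obtain N where N: "\<bar>\<Sum>k<n. \<xi> k \<omega>\<bar> \<le> real n powr (1/2 + \<epsilon>)" if "n \<ge> N" for n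
      by (auto simp: eventually_sequentially E_def not_less)
    \<comment> \<open>The summand 1 serves \<open>n \<ge> N\<close>, the sum serves the finitely
      many smaller \<open>n\<close>. At \<open>n = 0\<close> both sides vanish, since
      \<open>0 powr _\<close> is 0.\<close>
    define C where "C = 1 + (\<Sum>n<N. \<bar>\<Sum>k<n. \<xi> k \<omega>\<bar>)"
    have C1: "C \<ge> 1"
      by (simp add: C_def sum_nonneg)
    have "\<bar>\<Sum>k<n. \<xi> k \<omega>\<bar> \<le> C * real n powr (1/2 + \<epsilon>)" for n
    proof (cases "n \<ge> N")
      case True
      with N[of n] C1 show ?thesis
        by (meson mult_le_cancel_right1 order_trans powr_ge_zero not_less)
    next
      case False
      show ?thesis
      proof (cases "n = 0")
        case n: False
        have "\<bar>\<Sum>k<n. \<xi> k \<omega>\<bar> \<le> (\<Sum>n<N. \<bar>\<Sum>k<n. \<xi> k \<omega>\<bar>)"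
          using False by (intro member_le_sum) auto
        also have "\<dots> \<le> C"
          by (simp add: C_def)
        also have "\<dots> \<le> C * real n powr (1/2 + \<epsilon>)"
          using n C1 \<open>\<epsilon> > 0\<close> by (simp add: ge_one_powr_ge_zero)
        finally show ?thesis .
      qed auto
    qed
    then show ?case
      by blast
  qed
qed

end

section \<open>Holomorphic extension of the Dirichlet series\<close>

text \<open>This isolates the randomness: the analytic part below is deterministic and assumes this
  property of the coefficients.\<close>

definition sqrt_cancellation :: "(nat \<Rightarrow> real) \<Rightarrow> bool" where
  "sqrt_cancellation x \<longleftrightarrow> (\<forall>\<epsilon>>0. \<exists>C. \<forall>n. \<bar>\<Sum>k<n. x k\<bar> \<le> C * real n powr (1/2 + \<epsilon>))"

text \<open>The power of \<open>Suc k\<close> is written as an exponential, which makes the sum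
  visibly entire and easy to differentiate termwise.\<close>

definition dirichlet_partial :: "(nat \<Rightarrow> real) \<Rightarrow> nat \<Rightarrow> complex \<Rightarrow> complex" where
  "dirichlet_partial x n z = (\<Sum>k<n. of_real (x k) * exp (- z * of_real (ln (real (Suc k)))))"

definition dirichlet_ext :: "(nat \<Rightarrow> real) \<Rightarrow> complex \<Rightarrow> complex" where
  "dirichlet_ext x z = lim (\<lambda>n. dirichlet_partial x n z)"

text \<open>Consecutive terms differ by the factor \<open>exp (- z * h)\<close> with
  \<open>0 \<le> h \<le> 1 / Suc k\<close>, which is within O(h) of 1 for bounded \<open>z\<close>.
  The gain of one power of \<open>Suc k\<close> is what Abel summation needs.\<close>

lemma norm_exp_diff_le:
  fixes z :: complex
  assumes "norm z \<le> R"
  defines "e \<equiv> \<lambda>k. exp (- z * of_real (ln (real (Suc k))))"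
  shows "norm (e k - e (Suc k)) \<le> exp R * R * real (Suc k) powr (- Re z - 1)"
proof -
  define h where "h = ln (real (Suc (Suc k))) - ln (real (Suc k))"
  have h: "0 \<le> h" "h \<le> 1 / real (Suc k)"
    using ln_diff_le_inverse[of "real (Suc k)"] by (auto simp: h_def add_ac)
  then have h1: "h \<le> 1"
    by (smt (verit) divide_le_eq_1 of_nat_Suc of_nat_0_le_iff)
  have R: "R \<ge> 0"
    using assms(1) norm_ge_zero order_trans by blast
  have "e (Suc k) = e k * exp (- z * of_real h)"
    by (simp add: e_def h_def exp_add[symmetric] algebra_simps)
  then have "norm (e k - e (Suc k)) = norm (e k) * norm (exp (- z * of_real h) - 1)"
    by (metis mult.right_neutral norm_minus_commute norm_mult right_diff_distrib)
  also have "norm (exp (- z * of_real h) - 1) \<le> exp \<bar>Re (- z * of_real h)\<bar> * norm (- z * of_real h)"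
    using Taylor_exp[of "- z * of_real h" 0] by simp
  also have "\<dots> \<le> exp R * (R * (1 / real (Suc k)))"
  proof (intro mult_mono)
    have "\<bar>Re z\<bar> * h \<le> R * 1"
      using h h1 R assms(1) abs_Re_le_cmod[of z] by (intro mult_mono) linarith+
    then show "exp \<bar>Re (- z * of_real h)\<bar> \<le> exp R"
      using h by (simp add: abs_mult)
    show "norm (- z * of_real h) \<le> R * (1 / real (Suc k))"
      using mult_mono[OF assms(1) h(2) R h(1)] h(1) by (simp add: norm_mult del: of_nat_Suc)
  qed (use R in auto)
  also have "norm (e k) = real (Suc k) powr (- Re z)"
    by (simp add: e_def norm_exp_eq_Re powr_def del: of_nat_Suc)
  also have "real (Suc k) powr (- Re z) * (exp R * (R * (1 / real (Suc k))))
      = exp R * R * real (Suc k) powr (- Re z - 1)"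
    by (simp add: powr_diff)
  finally show ?thesis
    by (simp add: mult_left_mono)
qed

text \<open>Abel summation turns the series into a boundary term of order n^(-\<eta>/2) and a series
  whose terms are of order k^(-1-\<eta>/2), uniformly on the region. The former tends to 0, the
  latter converges by the Weierstrass test.\<close>

lemma uniform_limit_dirichlet_partial:
  assumes x: "sqrt_cancellation x" and "\<eta> > 0"
  shows "uniform_limit {z. Re z > 1/2 + \<eta> \<and> norm z < R} (dirichlet_partial x) (dirichlet_ext x) sequentially"
    (is "uniform_limit ?A _ _ _")
proof (cases "R > 0")
  case False
  then have empty: "?A = {}"
    by (auto simp: not_less intro: order_trans[OF _ norm_ge_zero])
  show ?thesis
    unfolding empty uniform_limit_iff by simp
next
  case True
  define S where "S n = (\<Sum>k<n. x k)" for n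
  \<comment> \<open>Half of the margin \<open>\<eta>\<close> is spent on the growth of the partial
    sums; the other half remains for convergence.\<close>
  obtain C where C: "\<bar>S n\<bar> \<le> C * real n powr (1/2 + \<eta>/2)" for n
    using x \<open>\<eta> > 0\<close> unfolding sqrt_cancellation_def S_def by (metis half_gt_zero)
  have "C \<ge> 0"
    using C[of 1] by simp
  define e where "e k z = exp (- z * of_real (ln (real (Suc k))))" for k and z :: complex
  have norm_e: "norm (e k z) = real (Suc k) powr (- Re z)" for k z
    by (simp add: e_def norm_exp_eq_Re powr_def del: of_nat_Suc)
  define f where "f k z = of_real (S (Suc k)) * (e k z - e (Suc k) z)" for k z
  have abel: "dirichlet_partial x n z = of_real (S n) * e n z + (\<Sum>k<n. f k z)" for n z
  proof (induction n)
    case (Suc n)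
    have "dirichlet_partial x (Suc n) z = dirichlet_partial x n z + of_real (x n) * e n z"
      by (simp add: dirichlet_partial_def e_def)
    also have "of_real (x n) = of_real (S (Suc n)) - (of_real (S n) :: complex)"
      by (simp add: S_def)
    finally show ?case
      by (simp add: Suc f_def algebra_simps)
  qed (simp add: dirichlet_partial_def S_def)
  define b where "b k = C * (exp R * R) * real (Suc k) powr (- 1 - \<eta>/2)" for k
  have lim1: "uniform_limit ?A (\<lambda>n z. \<Sum>k<n. f k z) (\<lambda>z. \<Sum>k. f k z) sequentially"
  proof (rule Weierstrass_m_test)
    show "summable b"
      unfolding b_def using \<open>\<eta> > 0\<close>
      by (intro summable_mult) (subst summable_Suc_iff[of "\<lambda>k. real k powr (- 1 - \<eta>/2)"], simp add: summable_real_powr_iff)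
    fix k z assume z: "z \<in> ?A"
    have "norm (f k z) = \<bar>S (Suc k)\<bar> * norm (e k z - e (Suc k) z)"
      by (simp add: f_def norm_mult)
    also have "\<dots> \<le> (C * real (Suc k) powr (1/2 + \<eta>/2)) * (exp R * R * real (Suc k) powr (- Re z - 1))"
      unfolding e_def using z C \<open>C \<ge> 0\<close> by (intro mult_mono norm_exp_diff_le) (auto simp del: of_nat_Suc)
    also have "\<dots> = C * (exp R * R) * real (Suc k) powr (1/2 + \<eta>/2 - Re z - 1)"
      by (simp add: powr_add[symmetric] algebra_simps del: of_nat_Suc)
    also have "\<dots> \<le> b k"
      unfolding b_def using z \<open>C \<ge> 0\<close> \<open>R > 0\<close> by (intro mult_left_mono powr_mono) auto
    finally show "norm (f k z) \<le> b k" .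
  qed
  have lim2: "uniform_limit ?A (\<lambda>n z. of_real (S n) * e n z) (\<lambda>z. 0) sequentially"
  proof (rule uniform_limitI)
    fix \<delta> :: real assume "\<delta> > 0"
    have "filterlim (\<lambda>n. real (Suc n)) at_top sequentially"
      by (rule filterlim_compose[OF filterlim_real_sequentially filterlim_Suc])
    then have "(\<lambda>n. C * real (Suc n) powr (- \<eta>/2)) \<longlonglongrightarrow> C * 0"
      using \<open>\<eta> > 0\<close> by (intro tendsto_intros tendsto_neg_powr) auto
    then have "eventually (\<lambda>n. C * real (Suc n) powr (- \<eta>/2) < \<delta>) sequentially"
      using \<open>\<delta> > 0\<close> by (simp add: order_tendstoD)
    then show "\<forall>\<^sub>F n in sequentially. \<forall>z\<in>?A. dist (of_real (S n) * e n z) 0 < \<delta>"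
    proof eventually_elim
      case (elim n)
      show ?case
      proof
        fix z assume z: "z \<in> ?A"
        have "norm (of_real (S n) * e n z) = \<bar>S n\<bar> * real (Suc n) powr (- Re z)"
          by (simp add: norm_mult norm_e del: of_nat_Suc)
        also have "\<dots> \<le> (C * real (Suc n) powr (1/2 + \<eta>/2)) * real (Suc n) powr (- Re z)"
        proof (intro mult_right_mono order_trans[OF C])
          show "C * real n powr (1/2 + \<eta>/2) \<le> C * real (Suc n) powr (1/2 + \<eta>/2)"
            using \<open>C \<ge> 0\<close> \<open>\<eta> > 0\<close> by (intro mult_left_mono powr_mono2) auto
        qed auto
        also have "\<dots> = C * real (Suc n) powr (1/2 + \<eta>/2 - Re z)"
          by (simp add: powr_add[symmetric] algebra_simps del: of_nat_Suc)
        also have "\<dots> \<le> C * real (Suc n) powr (- \<eta>/2)"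
          using z \<open>C \<ge> 0\<close> by (intro mult_left_mono powr_mono) auto
        finally show "dist (of_real (S n) * e n z) 0 < \<delta>"
          using elim by simp
      qed
    qed
  qed
  have "uniform_limit ?A (dirichlet_partial x) (\<lambda>z. 0 + (\<Sum>k. f k z)) sequentially"
    using uniform_limit_add[OF lim2 lim1] by (simp add: abel[abs_def])
  then have lim: "uniform_limit ?A (dirichlet_partial x) (\<lambda>z. \<Sum>k. f k z) sequentially"
    by simp
  moreover have "(\<Sum>k. f k z) = dirichlet_ext x z" if "z \<in> ?A" for z
    unfolding dirichlet_ext_def using tendsto_uniform_limitI[OF lim that]
    by (rule limI[symmetric])
  ultimately show ?thesis
    using uniform_limit_cong'[of ?A "dirichlet_partial x" "dirichlet_partial x" "\<lambda>z. \<Sum>k. f k z" "dirichlet_ext x" sequentially]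
    by blast
qed

lemma holomorphic_dirichlet_partial: "dirichlet_partial x n holomorphic_on A"
  unfolding dirichlet_partial_def[abs_def] by (intro holomorphic_intros)

lemma halfplane_nhd:
  assumes "Re z > 1/2"
  obtains \<eta> R where "\<eta> > 0" "z \<in> {z. Re z > 1/2 + \<eta> \<and> norm z < R}"
proof
  show "(Re z - 1/2) / 2 > 0" "z \<in> {w. Re w > 1/2 + (Re z - 1/2) / 2 \<and> norm w < norm z + 1}"
    using assms by (auto simp: field_simps)
qed

lemma open_halfplane_nhd: "open {z. Re z > 1/2 + \<eta> \<and> norm z < R}"
  by (intro open_Collect_conj open_Collect_less continuous_intros)

lemma dirichlet_partial_tendsto:
  assumes "sqrt_cancellation x" "Re z > 1/2"
  shows "(\<lambda>n. dirichlet_partial x n z) \<longlonglongrightarrow> dirichlet_ext x z"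
proof -
  obtain \<eta> R where "\<eta> > 0" "z \<in> {z. Re z > 1/2 + \<eta> \<and> norm z < R}"
    using halfplane_nhd[OF assms(2)] .
  then show ?thesis
    by (intro tendsto_uniform_limitI[OF uniform_limit_dirichlet_partial[OF assms(1)]])
qed

text \<open>Locally uniform limits of holomorphic functions may be differentiated. This exhibits
  every Taylor coefficient as a limit of finite Gaussian sums, to which the probability estimates
  apply.\<close>

lemma higher_deriv_dirichlet_partial_tendsto:
  assumes "sqrt_cancellation x" "Re z > 1/2"
  shows "(\<lambda>n. (deriv ^^ j) (dirichlet_partial x n) z) \<longlonglongrightarrow> (deriv ^^ j) (dirichlet_ext x) z"
proof -
  obtain \<eta> R where "\<eta> > 0" "z \<in> {z. Re z > 1/2 + \<eta> \<and> norm z < R}"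
    using halfplane_nhd[OF assms(2)] .
  then show ?thesis
    using holomorphic_dirichlet_partial open_halfplane_nhd
    by (intro higher_deriv_complex_uniform_limit[OF uniform_limit_dirichlet_partial[OF assms(1) \<open>\<eta> > 0\<close>, of R]])
       simp_all
qed

lemma holomorphic_dirichlet_ext:
  assumes "sqrt_cancellation x"
  shows "dirichlet_ext x holomorphic_on {z. Re z > 1/2}"
proof (rule holomorphic_uniform_sequence)
  show "open {z. Re z > 1/2}"
    by (rule open_halfspace_Re_gt)
  fix z assume "z \<in> {z. Re z > 1/2}"
  then obtain \<eta> R where *: "\<eta> > 0" "z \<in> {z. Re z > 1/2 + \<eta> \<and> norm z < R}"
    using halfplane_nhd[of z] by blast
  then obtain d where d: "d > 0" "cball z d \<subseteq> {z. Re z > 1/2 + \<eta> \<and> norm z < R}"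
    using open_halfplane_nhd[of \<eta> R] unfolding open_contains_cball by blast
  then have "uniform_limit (cball z d) (dirichlet_partial x) (dirichlet_ext x) sequentially"
    by (intro uniform_limit_on_subset[OF uniform_limit_dirichlet_partial[OF assms \<open>\<eta> > 0\<close>]])
  moreover have "cball z d \<subseteq> {z. Re z > 1/2}"
    using d(2) \<open>\<eta> > 0\<close> by (auto simp: subset_iff)
  ultimately show "\<exists>d>0. cball z d \<subseteq> {z. Re z > 1/2} \<and>
      uniform_limit (cball z d) (dirichlet_partial x) (dirichlet_ext x) sequentially"
    using d(1) by blast
qed (rule holomorphic_dirichlet_partial)

lemma higher_deriv_dirichlet_partial:
  "(deriv ^^ j) (dirichlet_partial x n) = (\<lambda>z. \<Sum>k<n. of_real (x k) *
     (of_real (- ln (real (Suc k))) ^ j * exp (- z * of_real (ln (real (Suc k))))))"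
proof (induction j)
  case (Suc j)
  have "((\<lambda>z. \<Sum>k<n. of_real (x k) * (of_real (- ln (real (Suc k))) ^ j * exp (- z * of_real (ln (real (Suc k))))))
     has_field_derivative (\<Sum>k<n. of_real (x k) *
     (of_real (- ln (real (Suc k))) ^ Suc j * exp (- z * of_real (ln (real (Suc k))))))) (at z)" for z :: complex
    by (auto intro!: derivative_eq_intros sum.cong)
  then show ?case
    by (simp add: Suc DERIV_imp_deriv fun_eq_iff del: of_nat_Suc power_Suc)
qed (simp add: dirichlet_partial_def fun_eq_iff)

lemma higher_deriv_dirichlet_partial_of_real:
  "(deriv ^^ j) (dirichlet_partial x n) (of_real \<sigma>)
    = of_real (\<Sum>k<n. (- ln (real (Suc k))) ^ j * real (Suc k) powr (- \<sigma>) * x k)"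
proof -
  have "exp (- of_real \<sigma> * of_real (ln (real (Suc k)))) = (of_real (real (Suc k) powr (- \<sigma>)) :: complex)" for k
    by (simp add: powr_def flip: exp_of_real del: of_nat_Suc)
  then show ?thesis
    unfolding higher_deriv_dirichlet_partial by (simp add: mult_ac del: of_nat_Suc)
qed

lemma dirichlet_partial_of_real:
  "dirichlet_partial x n (of_real \<sigma>) = of_real (\<Sum>k<n. real (Suc k) powr (- \<sigma>) * x k)"
  using higher_deriv_dirichlet_partial_of_real[of 0] by simp

text \<open>At real points the partial sums are real, hence so is the limit. Real zeros of the
  series are therefore exactly the real zeros of the holomorphic extension.\<close>

lemma dirichlet_sums:
  assumes "sqrt_cancellation x" "\<sigma> > 1/2"
  shows "(\<lambda>k. x k * real (Suc k) powr (- \<sigma>)) sums Re (dirichlet_ext x (of_real \<sigma>))"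
    and "dirichlet_ext x (of_real \<sigma>) = of_real (Re (dirichlet_ext x (of_real \<sigma>)))"
proof -
  have *: "(\<lambda>n. dirichlet_partial x n (of_real \<sigma>)) \<longlonglongrightarrow> dirichlet_ext x (of_real \<sigma>)"
    using assms by (intro dirichlet_partial_tendsto) auto
  from tendsto_Re[OF *] show "(\<lambda>k. x k * real (Suc k) powr (- \<sigma>)) sums Re (dirichlet_ext x (of_real \<sigma>))"
    by (simp add: sums_def dirichlet_partial_of_real mult.commute)
  from tendsto_Im[OF *] have "Im (dirichlet_ext x (of_real \<sigma>)) = 0"
    by (simp add: dirichlet_partial_of_real LIMSEQ_const_iff)
  then show "dirichlet_ext x (of_real \<sigma>) = of_real (Re (dirichlet_ext x (of_real \<sigma>)))"
    by (simp add: complex_eq_iff)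
qed

text \<open>Cancellation with exponent 1 already gives coefficients of linear growth, so all terms
  after the constant one are together O(2^(-\<sigma>)).\<close>

lemma dirichlet_ext_tendsto_at_top:
  assumes x: "sqrt_cancellation x"
  shows "((\<lambda>\<sigma>. Re (dirichlet_ext x (of_real \<sigma>))) \<longlongrightarrow> x 0) at_top"
proof -
  obtain C where C: "\<bar>\<Sum>k<n. x k\<bar> \<le> C * real n" for n
  proof -
    obtain C where C: "\<bar>\<Sum>k<n. x k\<bar> \<le> C * real n powr (1/2 + 1/2)" for n
      using x unfolding sqrt_cancellation_def by (metis half_gt_zero zero_less_one)
    have "\<bar>\<Sum>k<n. x k\<bar> \<le> C * real n" for n
      using C[of n] by simp
    then show ?thesis ..
  qed
  have C0: "C \<ge> 0"
    using C[of 1] by simp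
  have xb: "\<bar>x k\<bar> \<le> 2 * C * real (Suc k)" for k
  proof -
    have "\<bar>x k\<bar> = \<bar>(\<Sum>i<Suc k. x i) - (\<Sum>i<k. x i)\<bar>"
      by simp
    also have "\<dots> \<le> C * real (Suc k) + C * real k"
      using C[of "Suc k"] C[of k] by linarith
    also have "\<dots> \<le> 2 * C * real (Suc k)"
      using C0 by (simp add: algebra_simps)
    finally show ?thesis .
  qed
  define K where "K = (\<Sum>k. 2 * C * real (Suc (Suc k)) powr -3)"
  have sK: "summable (\<lambda>k. 2 * C * real (Suc (Suc k)) powr -3)"
    by (intro summable_mult, subst summable_Suc_iff[of "\<lambda>k. real (Suc k) powr -3"],
        subst summable_Suc_iff[of "\<lambda>k. real k powr -3"], simp add: summable_real_powr_iff)
  have bound: "\<bar>Re (dirichlet_ext x (of_real \<sigma>)) - x 0\<bar> \<le> K * 2 powr (4 - \<sigma>)" if "\<sigma> \<ge> 4" for \<sigma>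
  proof -
    have "(\<lambda>k. x k * real (Suc k) powr (- \<sigma>)) sums Re (dirichlet_ext x (of_real \<sigma>))"
      using that by (intro dirichlet_sums x) auto
    then have "(\<lambda>k. x (Suc k) * real (Suc (Suc k)) powr (- \<sigma>)) sums (Re (dirichlet_ext x (of_real \<sigma>)) - x 0)"
      by (subst sums_Suc_iff) simp
    moreover have "(\<lambda>k. 2 * C * real (Suc (Suc k)) powr -3 * 2 powr (4 - \<sigma>)) sums (K * 2 powr (4 - \<sigma>))"
      unfolding K_def by (intro sums_mult2 summable_sums sK)
    ultimately have "norm (Re (dirichlet_ext x (of_real \<sigma>)) - x 0) \<le> K * 2 powr (4 - \<sigma>)"
    proof (rule norm_sums_le)
      fix k
      let ?n = "real (Suc (Suc k))"
      have "norm (x (Suc k) * ?n powr (- \<sigma>)) \<le> 2 * C * ?n * ?n powr (- \<sigma>)"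
        using mult_right_mono[OF xb[of "Suc k"], of "?n powr (- \<sigma>)"] by (simp add: abs_mult)
      also have "\<dots> = 2 * C * (?n powr 1 * ?n powr -\<sigma>)"
        by (simp del: of_nat_Suc)
      \<comment> \<open>The factor with exponent -3 keeps the sum convergent; the other is at most
        \<open>2 powr (4 - \<sigma>)\<close> because \<open>?n \<ge> 2\<close> and
        \<open>\<sigma> \<ge> 4\<close>.\<close>
      also have "?n powr 1 * ?n powr -\<sigma> = ?n powr -3 * ?n powr (4 - \<sigma>)"
        unfolding powr_add[symmetric] by simp
      also have "2 * C * (?n powr -3 * ?n powr (4 - \<sigma>)) \<le> 2 * C * (?n powr -3 * 2 powr (4 - \<sigma>))"
        using C0 that by (intro mult_left_mono powr_mono2') auto
      finally show "norm (x (Suc k) * ?n powr (- \<sigma>)) \<le> 2 * C * ?n powr -3 * 2 powr (4 - \<sigma>)"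
        by (simp add: mult_ac)
    qed
    then show ?thesis
      by simp
  qed
  have "((\<lambda>\<sigma>::real. K * 2 powr (4 - \<sigma>)) \<longlongrightarrow> 0) at_top"
    by real_asymp
  then have "((\<lambda>\<sigma>. Re (dirichlet_ext x (of_real \<sigma>)) - x 0) \<longlongrightarrow> 0) at_top"
    by (rule Lim_null_comparison[rotated])
       (use bound in \<open>auto intro!: eventually_mono[OF eventually_ge_at_top[of 4]]\<close>)
  then show ?thesis
    by (simp add: LIM_zero_iff)
qed

text \<open>The nonzero limit at infinity confines the zeros to a compact interval, where a
  nonconstant holomorphic function has finitely many. A constant function has no zeros, since it is
  nonzero at \<open>b\<close>.\<close>

lemma finite_zeros_dirichlet_ext:
  assumes x: "sqrt_cancellation x" "x 0 \<noteq> 0" and "a > 1/2"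
  shows "finite {\<sigma>. a \<le> \<sigma> \<and> dirichlet_ext x (of_real \<sigma>) = 0}"
proof -
  have "eventually (\<lambda>\<sigma>. Re (dirichlet_ext x (of_real \<sigma>)) \<noteq> 0) at_top"
    using dirichlet_ext_tendsto_at_top[OF x(1)] x(2) by (rule tendsto_imp_eventually_ne)
  then obtain b' where "\<forall>\<sigma>\<ge>b'. Re (dirichlet_ext x (of_real \<sigma>)) \<noteq> 0"
    by (auto simp: eventually_at_top_linorder)
  then obtain b where b: "b > a" "\<And>\<sigma>. \<sigma> \<ge> b \<Longrightarrow> dirichlet_ext x (of_real \<sigma>) \<noteq> 0"
    by (metis gt_ex max.strict_boundedE max.bounded_iff nle_le order_less_imp_le zero_complex.sel(1))
  let ?S = "{z. Re z > 1/2}"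
  have b0: "dirichlet_ext x (of_real b) \<noteq> 0"
    using b by simp
  have fin: "finite {z\<in>of_real ` {a..b}. dirichlet_ext x z = 0}"
  proof (cases "dirichlet_ext x constant_on ?S")
    case True
    then obtain y where y: "dirichlet_ext x z = y" if "z \<in> ?S" for z
      by (auto simp: constant_on_def)
    have "dirichlet_ext x z \<noteq> 0" if "z \<in> of_real ` {a..b}" for z
      using that \<open>a > 1/2\<close> b0 y[of z] y[of "of_real b"] b(1) by auto
    then have empty: "{z\<in>of_real ` {a..b}. dirichlet_ext x z = 0} = {}"
      by blast
    show ?thesis
      unfolding empty by simp
  next
    case False
    show ?thesis
    proof (rule holomorphic_compact_finite_zeros[OF holomorphic_dirichlet_ext[OF x(1)] _ _ _ _ False])
      show "open ?S"
        by (rule open_halfspace_Re_gt)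
      show "connected ?S"
        by (intro convex_connected convex_halfspace_Re_gt)
      show "compact (of_real ` {a..b} :: complex set)"
        by (intro compact_continuous_image continuous_intros) auto
    qed (use \<open>a > 1/2\<close> in auto)
  qed
  have "{\<sigma>. a \<le> \<sigma> \<and> dirichlet_ext x (of_real \<sigma>) = 0} \<subseteq> Re ` {z\<in>of_real ` {a..b}. dirichlet_ext x z = 0}"
  proof
    fix \<sigma> assume "\<sigma> \<in> {\<sigma>. a \<le> \<sigma> \<and> dirichlet_ext x (of_real \<sigma>) = 0}"
    then have "of_real \<sigma> \<in> {z\<in>of_real ` {a..b}. dirichlet_ext x z = 0}"
      using b(2)[of \<sigma>] by (cases "b \<le> \<sigma>") auto
    then show "\<sigma> \<in> Re ` {z\<in>of_real ` {a..b}. dirichlet_ext x z = 0}"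
      by force
  qed
  then show ?thesis
    using fin finite_subset by blast
qed

section \<open>Zeros near a centre\<close>

lemma powr_neg_diff_ge:
  assumes "\<delta> > 0" "n \<ge> (1::nat)"
  shows "\<delta> * real (Suc n) powr (- 1 - \<delta>) \<le> real n powr (- \<delta>) - real (Suc n) powr (- \<delta>)"
proof -
  let ?N = "real (Suc n)"
  have "1 / ?N \<le> ln ?N - ln (real n)"
  proof -
    have "ln (real n / ?N) \<le> real n / ?N - 1"
      using assms by (intro ln_le_minus_one) auto
    then show ?thesis
      using assms by (simp add: ln_div field_simps)
  qed
  \<comment> \<open>The inequality \<open>1 + y \<le> exp y\<close> replaces an integral comparison
    and produces a bound that telescopes in \<open>sum_powr_le\<close>.\<close>
  then have "1 + \<delta> * (1 / ?N) \<le> 1 + \<delta> * (ln ?N - ln (real n))"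
    using assms by (intro add_left_mono mult_left_mono) auto
  also have "\<dots> \<le> exp (\<delta> * (ln ?N - ln (real n)))"
    by (rule exp_ge_add_one_self)
  finally have "?N powr (- \<delta>) * (1 + \<delta> * (1 / ?N)) \<le> ?N powr (- \<delta>) * exp (\<delta> * (ln ?N - ln (real n)))"
    by (intro mult_left_mono) auto
  also have "\<dots> = real n powr (- \<delta>)"
    using assms by (simp add: powr_def exp_add[symmetric] algebra_simps del: of_nat_Suc)
  finally show ?thesis
    by (simp add: powr_diff powr_minus field_simps del: of_nat_Suc)
qed

lemma sum_powr_le:
  assumes "\<delta> > 0"
  shows "(\<Sum>m<n. real (Suc m) powr (- 1 - \<delta>)) \<le> 1 + 1 / \<delta>"
proof -
  have "(\<Sum>m<Suc n. real (Suc m) powr (- 1 - \<delta>)) \<le> 1 + (1 - real (Suc n) powr (- \<delta>)) / \<delta>" for n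
  proof (induction n)
    case (Suc n)
    have "real (Suc (Suc n)) powr (- 1 - \<delta>)
        \<le> (real (Suc n) powr (- \<delta>) - real (Suc (Suc n)) powr (- \<delta>)) / \<delta>"
      using powr_neg_diff_ge[OF assms, of "Suc n"] assms by (simp add: field_simps del: of_nat_Suc)
    with Suc show ?case
      by (simp add: diff_divide_distrib del: of_nat_Suc)
  qed simp
  then have *: "(\<Sum>m<Suc n. real (Suc m) powr (- 1 - \<delta>)) \<le> 1 + (1 - real (Suc n) powr (- \<delta>)) / \<delta>" .
  have "(\<Sum>m<n. real (Suc m) powr (- 1 - \<delta>)) \<le> (\<Sum>m<Suc n. real (Suc m) powr (- 1 - \<delta>))"
    by simp
  also note *
  also have "1 + (1 - real (Suc n) powr (- \<delta>)) / \<delta> \<le> 1 + 1 / \<delta>"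
    using assms by (intro add_left_mono divide_right_mono) auto
  finally show ?thesis .
qed

text \<open>On the range \<open>Suc m \<le> q\<close>, so the factor with exponent
  \<open>- 2 * \<delta>\<close> is at least its value at \<open>q\<close>, and what remains is a
  harmonic sum bounded below by a telescoping logarithm.\<close>

lemma sum_powr_ge:
  assumes "\<delta> > 0" "p \<le> q"
  shows "(\<Sum>m\<in>{p..<q}. real (Suc m) powr (- 1 - 2 * \<delta>))
      \<ge> real q powr (- 2 * \<delta>) * (ln (real (Suc q)) - ln (real (Suc p)))"
proof -
  have "real q powr (- 2 * \<delta>) * (ln (real (Suc q)) - ln (real (Suc p)))
      = (\<Sum>m\<in>{p..<q}. real q powr (- 2 * \<delta>) * (ln (real (Suc (Suc m))) - ln (real (Suc m))))"
    using sum_Suc_diff'[OF \<open>p \<le> q\<close>, of "\<lambda>m. ln (real (Suc m))"] by (simp add: sum_distrib_left[symmetric] del: of_nat_Suc)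
  also have "\<dots> \<le> (\<Sum>m\<in>{p..<q}. real (Suc m) powr (- 1 - 2 * \<delta>))"
  proof (rule sum_mono)
    fix m assume m: "m \<in> {p..<q}"
    have "ln (real (Suc (Suc m))) - ln (real (Suc m)) \<le> 1 / real (Suc m)"
      using ln_diff_le_inverse[of "real (Suc m)"] by (simp add: add_ac)
    moreover have "real q powr (- 2 * \<delta>) \<le> real (Suc m) powr (- 2 * \<delta>)"
      using m assms by (intro powr_mono2') auto
    ultimately have "real q powr (- 2 * \<delta>) * (ln (real (Suc (Suc m))) - ln (real (Suc m)))
        \<le> real (Suc m) powr (- 2 * \<delta>) * (1 / real (Suc m))"
      by (intro mult_mono) auto
    also have "\<dots> = real (Suc m) powr (- 1 - 2 * \<delta>)"
      by (simp add: powr_diff powr_minus field_simps del: of_nat_Suc)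
    finally show "real q powr (- 2 * \<delta>) * (ln (real (Suc (Suc m))) - ln (real (Suc m)))
        \<le> real (Suc m) powr (- 1 - 2 * \<delta>)" .
  qed
  finally show ?thesis .
qed

lemma power_le_fact_mult_exp:
  assumes "y \<ge> (0::real)"
  shows "y ^ n \<le> fact n * exp y"
proof -
  have "(\<Sum>k\<in>{n}. y ^ k /\<^sub>R fact k) \<le> (\<Sum>k. y ^ k /\<^sub>R fact k)"
    using assms by (intro sum_le_suminf summable_exp_generic) auto
  then have "y ^ n / fact n \<le> exp y"
    by (simp add: exp_def divide_inverse_commute)
  then show ?thesis
    by (simp add: field_simps)
qed

text \<open>The sum bounds the variance of the j-th Taylor coefficient at
  \<open>1/2 + \<delta>\<close>, scaled by \<open>\<delta> ^ j\<close>. One factor N^\<delta> of the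
  decay N^(-1-2\<delta>) pays for the logarithms through (\<delta> ln N)^(2j) \<le> (2j)!
  N^\<delta>; the factorials then leave a central binomial coefficient, at most 4^j.\<close>

lemma sum_taylor_weights_le:
  assumes "\<delta> > 0"
  shows "(\<Sum>m<n. (\<delta> ^ j / fact j * ((- ln (real (Suc m))) ^ j * real (Suc m) powr (- (1/2 + \<delta>))))\<^sup>2)
      \<le> 4 ^ j * (1 + 1 / \<delta>)"
proof -
  have "(\<delta> ^ j / fact j * ((- ln (real (Suc m))) ^ j * real (Suc m) powr (- (1/2 + \<delta>))))\<^sup>2
      \<le> 4 ^ j * real (Suc m) powr (- 1 - \<delta>)" for m
  proof -
    let ?N = "real (Suc m)"
    have "(\<delta> ^ j / fact j * ((- ln ?N) ^ j * ?N powr (- (1/2 + \<delta>))))\<^sup>2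
        = (\<delta> * ln ?N) ^ (2 * j) / (fact j)\<^sup>2 * (?N powr (- (1/2 + \<delta>)))\<^sup>2"
      by (simp add: power_mult_distrib power_divide power_mult[symmetric] mult.commute[of j] del: of_nat_Suc)
    also have "(?N powr (- (1/2 + \<delta>)))\<^sup>2 = ?N powr (- 1 - 2 * \<delta>)"
      by (simp add: power2_eq_square powr_add[symmetric] del: of_nat_Suc)
    also have "(\<delta> * ln ?N) ^ (2 * j) / (fact j)\<^sup>2 * ?N powr (- 1 - 2 * \<delta>)
        \<le> (fact (2 * j) * exp (\<delta> * ln ?N)) / (fact j)\<^sup>2 * ?N powr (- 1 - 2 * \<delta>)"
      using assms by (intro mult_right_mono divide_right_mono power_le_fact_mult_exp) auto
    also have "\<dots> = (fact (2 * j) / (fact j)\<^sup>2) * (?N powr \<delta> * ?N powr (- 1 - 2 * \<delta>))"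
      by (simp add: powr_def del: of_nat_Suc)
    also have "?N powr \<delta> * ?N powr (- 1 - 2 * \<delta>) = ?N powr (- 1 - \<delta>)"
      unfolding powr_add[symmetric] by (simp add: algebra_simps)
    also have "fact (2 * j) / (fact j)\<^sup>2 = real ((2 * j) choose j)"
      by (simp add: binomial_fact power2_eq_square)
    also have "\<dots> * ?N powr (- 1 - \<delta>) \<le> 4 ^ j * ?N powr (- 1 - \<delta>)"
    proof (intro mult_right_mono)
      have "real ((2 * j) choose j) \<le> real (2 ^ (2 * j))"
        by (intro of_nat_mono binomial_le_pow2)
      then show "real ((2 * j) choose j) \<le> 4 ^ j"
        by (simp add: power_mult)
    qed auto
    finally show ?thesis .
  qed
  then have "(\<Sum>m<n. (\<delta> ^ j / fact j * ((- ln (real (Suc m))) ^ j * real (Suc m) powr (- (1/2 + \<delta>))))\<^sup>2)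
      \<le> (\<Sum>m<n. 4 ^ j * real (Suc m) powr (- 1 - \<delta>))"
    by (rule sum_mono)
  also have "\<dots> \<le> 4 ^ j * (1 + 1 / \<delta>)"
    using sum_powr_le[OF assms] by (simp add: sum_distrib_left[symmetric])
  finally show ?thesis .
qed

text \<open>Cutting at n near exp(1/\<delta>) gives logarithmic length at least 1/\<delta>, while
  N^(-2\<delta>) stays above exp(-2) \<ge> 1/9.\<close>

lemma ex_sum_weights_ge:
  assumes "\<delta> > 0"
  shows "\<exists>n. (\<Sum>m<n. (real (Suc m) powr (- (1/2 + \<delta>)))\<^sup>2) \<ge> 1 / (9 * \<delta>)"
proof
  define n where "n = nat \<lfloor>exp (1 / \<delta>)\<rfloor>"
  have n: "real n \<le> exp (1 / \<delta>)" "exp (1 / \<delta>) \<le> real (Suc n)"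
    unfolding n_def by (simp_all add: of_nat_floor) linarith
  have "exp (1/\<delta>) \<ge> 1"
    using assms by simp
  then have n1: "n \<ge> 1"
    unfolding n_def by linarith
  have "1 / \<delta> \<le> ln (real (Suc n))"
    using n(2) by (subst ln_ge_iff) auto
  moreover have "1 / 9 \<le> real n powr (- 2 * \<delta>)"
  proof -
    have "exp (2::real) \<le> 3 * 3"
      using mult_mono[OF exp_le exp_le] by (simp add: exp_add[symmetric])
    then have "1 / 9 \<le> exp (-2::real)"
      by (simp add: exp_minus field_simps)
    also
    have "exp (-2) = exp (1 / \<delta>) powr (- 2 * \<delta>)"
      using assms by (simp add: powr_def)
    also have "\<dots> \<le> real n powr (- 2 * \<delta>)"
      using n n1 assms by (intro powr_mono2') auto
    finally show ?thesis .
  qed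
  ultimately have "1 / 9 * (1 / \<delta>) \<le> real n powr (- 2 * \<delta>) * ln (real (Suc n))"
    using assms by (intro mult_mono) auto
  also have "\<dots> \<le> (\<Sum>m<n. real (Suc m) powr (- 1 - 2 * \<delta>))"
    using sum_powr_ge[OF assms, of 0 n] by (simp add: atLeast0LessThan)
  finally show "(\<Sum>m<n. (real (Suc m) powr (- (1/2 + \<delta>)))\<^sup>2) \<ge> 1 / (9 * \<delta>)"
    by (simp add: power2_eq_square powr_add[symmetric] del: of_nat_Suc)
qed

text \<open>A Jensen-type inequality, proved by removing the zeros one at a time. Division by
  \<open>z - a\<close> raises the bound on the circle by at most the factor
  \<open>1 / (R - r)\<close>, and multiplying back at the centre costs at most \<open>r\<close>.
  Since \<open>f\<close> and \<open>B\<close> change with each division, the induction generalises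
  over both.\<close>

lemma holomorphic_zeros_norm_bound:
  assumes "f holomorphic_on S" "open S" "cball c R \<subseteq> S" "0 \<le> r" "r < R"
    and "finite Z" "Z \<subseteq> cball c r" "\<And>z. z \<in> Z \<Longrightarrow> f z = 0"
    and "\<And>z. dist c z = R \<Longrightarrow> norm (f z) \<le> B"
  shows "norm (f c) \<le> B * (r / (R - r)) ^ card Z"
  using assms(6,1,7-9)
proof (induction Z arbitrary: f B rule: finite_induct)
  case empty
  have "norm (f c) \<le> B"
  proof (rule maximum_modulus_frontier[of f "cball c R"])
    show "f holomorphic_on interior (cball c R)"
      by (rule holomorphic_on_subset[OF empty(1) order_trans[OF interior_subset assms(3)]])
    show "continuous_on (closure (cball c R)) f"
      using empty assms(3) by (auto intro: holomorphic_on_imp_continuous_on holomorphic_on_subset)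
    show "norm (f z) \<le> B" if "z \<in> frontier (cball c R)" for z
      using that empty assms(4,5) by (auto simp: frontier_cball)
  qed (use assms(4,5) in auto)
  then show ?case
    by simp
next
  case (insert a Z)
  \<comment> \<open>The value at \<open>a\<close> removes the singularity. The remaining zeros
    differ from \<open>a\<close>, so they are zeros of \<open>g\<close>.\<close>
  define g where "g = (\<lambda>z. if z = a then deriv f a else (f z - f a) / (z - a))"
  have [simp]: "f a = 0"
    using insert.prems by auto
  have a: "dist c a \<le> r"
    using insert.prems by auto
  have B0: "0 \<le> B"
  proof -
    have "dist c (c + of_real R) = R"
      using assms(4,5) by (simp add: dist_norm)
    from insert.prems(4)[OF this] show ?thesis
      by (meson norm_ge_zero order_trans)
  qed
  have "norm (g c) \<le> B / (R - r) * (r / (R - r)) ^ card Z"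
  proof (rule insert.IH)
    show "g holomorphic_on S"
      unfolding g_def by (rule pole_lemma_open[OF insert.prems(1) \<open>open S\<close>])
    show "Z \<subseteq> cball c r" "\<And>z. z \<in> Z \<Longrightarrow> g z = 0"
      using insert.prems insert.hyps by (auto simp: g_def)
    show "norm (g z) \<le> B / (R - r)" if z: "dist c z = R" for z
    proof -
      have "dist c z \<le> dist c a + dist z a"
        by (metis dist_commute dist_triangle)
      with z a have "R - r \<le> norm (z - a)"
        by (simp add: dist_norm)
      moreover have "z \<noteq> a"
        using z a assms(5) by auto
      ultimately show ?thesis
        using insert.prems(4)[OF z] assms(5) B0
        by (auto simp: g_def norm_divide intro!: frac_le)
    qed
  qed
  moreover have "norm (f c) \<le> r * norm (g c)"
  proof (cases "c = a")
    case False
    have "norm (f c) = norm (c - a) * norm (g c)"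
      using False by (simp add: g_def norm_divide)
    with a show ?thesis
      by (simp add: dist_norm mult_right_mono)
  qed (use \<open>0 \<le> r\<close> in auto)
  ultimately have "norm (f c) \<le> r * (B / (R - r) * (r / (R - r)) ^ card Z)"
    using \<open>0 \<le> r\<close> by (meson mult_left_mono order_trans)
  then show ?case
    using insert.hyps by (simp add: mult_ac)
qed

text \<open>At distance at most \<open>d / 8\<close> the j-th Taylor term is at most 4^j 8^(-j)
  \<open>B\<close>, and the geometric series sums to \<open>2 * B\<close>.\<close>

lemma norm_le_of_taylor_bounds:
  assumes "f holomorphic_on ball c d" "d > 0" "norm (w - c) \<le> d / 8"
    and a: "\<And>j. norm ((deriv ^^ j) f c) / fact j * d ^ j \<le> 4 ^ j * B"
  shows "norm (f w) \<le> 2 * B"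
proof (rule norm_sums_le)
  have "w \<in> ball c d"
    using assms(2,3) by (simp add: dist_norm norm_minus_commute)
  then show "(\<lambda>j. (deriv ^^ j) f c / fact j * (w - c) ^ j) sums f w"
    by (rule holomorphic_power_series[OF assms(1)])
  show "(\<lambda>j. B * (1/2) ^ j) sums (2 * B)"
    using sums_mult[OF geometric_sums[of "1/2::real"], of B] by (simp add: mult.commute)
  fix j
  have "norm ((deriv ^^ j) f c / fact j * (w - c) ^ j)
      = norm ((deriv ^^ j) f c) / fact j * norm (w - c) ^ j"
    by (simp add: norm_mult norm_divide norm_power)
  also have "\<dots> \<le> norm ((deriv ^^ j) f c) / fact j * (d / 8) ^ j"
    using assms(3) by (intro mult_left_mono power_mono) auto
  also have "\<dots> = (norm ((deriv ^^ j) f c) / fact j * d ^ j) * (1 / 8) ^ j"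
    by (simp add: power_divide)
  also have "\<dots> \<le> 4 ^ j * B * (1 / 8) ^ j"
    by (intro mult_right_mono a) auto
  also have "\<dots> = B * (1/2) ^ j"
    by (simp add: power_mult_distrib[symmetric] mult_ac)
  finally show "norm ((deriv ^^ j) f c / fact j * (w - c) ^ j) \<le> B * (1/2) ^ j" .
qed

text \<open>The radii \<open>d / 8\<close> and \<open>d / 24\<close> are chosen so that r / (R - r)
  = 1/2: every zero halves the value at the centre.\<close>

lemma norm_le_of_zeros_taylor_bounds:
  assumes f: "f holomorphic_on ball c d" "d > 0"
    and a: "\<And>j. norm ((deriv ^^ j) f c) / fact j * d ^ j \<le> 4 ^ j * B"
    and Z: "finite Z" "Z \<subseteq> cball c (d / 24)" "\<And>z. z \<in> Z \<Longrightarrow> f z = 0"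
  shows "norm (f c) \<le> 2 * B * (1/2) ^ card Z"
proof -
  have "norm (f c) \<le> 2 * B * ((d/24) / (d/8 - d/24)) ^ card Z"
  proof (rule holomorphic_zeros_norm_bound[OF f(1)])
    show "cball c (d / 8) \<subseteq> ball c d"
      using f(2) by auto
    show "norm (f z) \<le> 2 * B" if "dist c z = d / 8" for z
      using that f a by (intro norm_le_of_taylor_bounds[of f c d]) (auto simp: dist_norm norm_minus_commute)
  qed (use f Z in auto)
  also have "(d/24) / (d/8 - d/24) = 1 / 2"
    using f(2) by (simp add: field_simps)
  finally show ?thesis .
qed

text \<open>Comparing the lower bound for the value at the centre with the halving at each zero
  gives 2^(number of zeros) \<le> 6 sqrt 2 k^3. The factors \<open>sqrt \<delta>\<close> cancel, so
  the count is logarithmic in \<open>k\<close> at every scale.\<close>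

lemma card_zeros_near_center:
  assumes x: "sqrt_cancellation x" and "\<delta> > 0" "k > 0"
    and upper: "\<And>j. \<not> eventually (\<lambda>n. 4 ^ j * (real k * sqrt (2 / \<delta>)) <
        \<bar>\<Sum>m<n. \<delta> ^ j / fact j * ((- ln (real (Suc m))) ^ j * real (Suc m) powr (- (1/2 + \<delta>))) * x m\<bar>) sequentially"
    and lower: "\<not> eventually (\<lambda>n. \<bar>\<Sum>m<n. real (Suc m) powr (- (1/2 + \<delta>)) * x m\<bar>
        < 1 / (3 * sqrt \<delta> * real k ^ 2)) sequentially"
  defines "Z \<equiv> {\<sigma>. \<bar>\<sigma> - (1/2 + \<delta>)\<bar> \<le> \<delta> / 24 \<and> dirichlet_ext x (of_real \<sigma>) = 0}"
  shows "finite Z" "real (card Z) \<le> 4 + 6 * ln (real k)"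
proof -
  let ?F = "dirichlet_ext x" and ?c = "of_real (1/2 + \<delta>) :: complex"
  define B where "B = real k * sqrt (2 / \<delta>)"
  have holo: "?F holomorphic_on ball ?c \<delta>"
  proof (rule holomorphic_on_subset[OF holomorphic_dirichlet_ext[OF x]], safe)
    fix z assume "z \<in> ball ?c \<delta>"
    then have "\<bar>Re (?c - z)\<bar> < \<delta>"
      using abs_Re_le_cmod[of "?c - z"] by (simp add: dist_norm)
    then show "Re z > 1/2"
      by (simp add: abs_less_iff)
  qed
  have lim: "(\<lambda>n. (deriv ^^ j) (dirichlet_partial x n) ?c) \<longlonglongrightarrow> (deriv ^^ j) ?F ?c" for j
    using \<open>\<delta> > 0\<close> by (intro higher_deriv_dirichlet_partial_tendsto[OF x]) auto
  \<comment> \<open>A limit strictly above the bound would force the partial sums above it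
    eventually, which \<open>upper\<close> excludes. The bound at the centre follows from
    \<open>lower\<close> in the same way.\<close>
  have a: "norm ((deriv ^^ j) ?F ?c) / fact j * \<delta> ^ j \<le> 4 ^ j * B" for j
  proof (rule ccontr)
    assume less: "\<not> ?thesis"
    have "(\<lambda>n. norm ((deriv ^^ j) (dirichlet_partial x n) ?c) / fact j * \<delta> ^ j)
        \<longlonglongrightarrow> norm ((deriv ^^ j) ?F ?c) / fact j * \<delta> ^ j"
      by (intro tendsto_intros lim) auto
    moreover have "norm ((deriv ^^ j) (dirichlet_partial x n) ?c) / fact j * \<delta> ^ j
        = \<bar>\<Sum>m<n. \<delta> ^ j / fact j * ((- ln (real (Suc m))) ^ j * real (Suc m) powr (- (1/2 + \<delta>))) * x m\<bar>" for n
    proof -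
      have "norm ((deriv ^^ j) (dirichlet_partial x n) ?c) / fact j * \<delta> ^ j
          = \<bar>\<delta> ^ j / fact j * (\<Sum>m<n. (- ln (real (Suc m))) ^ j * real (Suc m) powr (- (1/2 + \<delta>)) * x m)\<bar>"
        using \<open>\<delta> > 0\<close> by (simp only: higher_deriv_dirichlet_partial_of_real norm_of_real) (simp add: abs_mult)
      then show ?thesis
        by (simp add: sum_distrib_left mult.assoc)
    qed
    ultimately have "eventually (\<lambda>n. 4 ^ j * B <
        \<bar>\<Sum>m<n. \<delta> ^ j / fact j * ((- ln (real (Suc m))) ^ j * real (Suc m) powr (- (1/2 + \<delta>))) * x m\<bar>) sequentially"
      using less by (simp add: order_tendstoD(1))
    with upper show False
      by (simp add: B_def)
  qed
  have b: "1 / (3 * sqrt \<delta> * real k ^ 2) \<le> norm (?F ?c)"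
  proof (rule ccontr)
    assume "\<not> ?thesis"
    moreover have "(\<lambda>n. norm (dirichlet_partial x n ?c)) \<longlonglongrightarrow> norm (?F ?c)"
      using lim[of 0] by (auto intro: tendsto_norm)
    ultimately have "eventually (\<lambda>n. norm (dirichlet_partial x n ?c) < 1 / (3 * sqrt \<delta> * real k ^ 2)) sequentially"
      by (simp add: order_tendstoD(2))
    with lower show False
      by (simp only: dirichlet_partial_of_real norm_of_real real_norm_def)
  qed
  \<comment> \<open>Finiteness of \<open>Z\<close> is not yet known; a uniform bound for its finite
    subsets yields both finiteness and the count.\<close>
  have card: "real (card Y) \<le> 4 + 6 * ln (real k)" if "finite Y" "Y \<subseteq> Z" for Y
  proof -
    have "norm (?F ?c) \<le> 2 * B * (1/2) ^ card (of_real ` Y :: complex set)"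
    proof (rule norm_le_of_zeros_taylor_bounds[OF holo \<open>\<delta> > 0\<close> a])
      show "of_real ` Y \<subseteq> cball ?c (\<delta> / 24)"
      proof safe
        fix \<sigma> assume "\<sigma> \<in> Y"
        with that have "\<bar>\<sigma> - (1/2 + \<delta>)\<bar> \<le> \<delta> / 24"
          by (auto simp: Z_def)
        then show "of_real \<sigma> \<in> cball ?c (\<delta> / 24)"
          unfolding mem_cball dist_of_real by (simp add: dist_real_def abs_minus_commute)
      qed
    qed (use that in \<open>auto simp: Z_def\<close>)
    also have "card (of_real ` Y :: complex set) = card Y"
      by (intro card_image) (auto simp: inj_on_def)
    finally have "1 / (3 * sqrt \<delta> * real k ^ 2) \<le> 2 * B * (1/2) ^ card Y"
      using b by linarith
    then have "2 ^ card Y \<le> (6 * sqrt 2) * real k ^ 3"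
      using \<open>\<delta> > 0\<close> \<open>k > 0\<close>
      by (simp add: B_def real_sqrt_divide field_simps power_one_over power2_eq_square power3_eq_cube)
    also have "6 * sqrt 2 \<le> (2 ^ 4 :: real)"
      using real_le_lsqrt[of 2 2] by simp
    finally have "2 ^ card Y \<le> 2 ^ 4 * real k ^ 3"
      by (simp add: mult_right_mono)
    then have "ln (2 ^ card Y) \<le> ln (2 ^ 4 * real k ^ 3)"
      using \<open>k > 0\<close> by (subst ln_le_cancel_iff) auto
    then have "real (card Y) * ln 2 \<le> 4 * ln 2 + 3 * ln (real k)"
      using \<open>k > 0\<close> ln_realpow[of "2::real" 4] by (simp add: ln_mult ln_realpow)
    moreover have "3 * ln (real k) \<le> 6 * ln (real k) * ln 2"
    proof -
      have "ln (real k) * (1/2) \<le> ln (real k) * ln 2"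
        using ln2_ge_two_thirds \<open>k > 0\<close> by (intro mult_left_mono) auto
      then show ?thesis
        by simp
    qed
    ultimately have "real (card Y) * ln 2 \<le> (4 + 6 * ln (real k)) * ln 2"
      by (simp add: algebra_simps)
    then show ?thesis
      by (simp add: mult_le_cancel_right)
  qed
  then have "card Y \<le> nat \<lfloor>4 + 6 * ln (real k)\<rfloor>" if "finite Y" "Y \<subseteq> Z" for Y
    using that by (meson le_nat_floor)
  then have "finite Z \<and> card Z \<le> nat \<lfloor>4 + 6 * ln (real k)\<rfloor>"
    by (intro finite_if_finite_subsets_card_bdd)
  then show "finite Z"
    by blast
  then show "real (card Z) \<le> 4 + 6 * ln (real k)"
    by (intro card) auto
qed

section \<open>The upper bound\<close>

lemma num_zeros_from_le:
  assumes "{\<sigma>. T \<le> \<sigma> \<and> f \<sigma> = 0} \<subseteq> A" "finite A" "real (card A) \<le> b"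
  shows "num_zeros_from f T \<le> ereal b"
proof -
  have "finite {\<sigma>. T \<le> \<sigma> \<and> f \<sigma> = 0}" "card {\<sigma>. T \<le> \<sigma> \<and> f \<sigma> = 0} \<le> card A"
    by (rule finite_subset[OF assms(1,2)], rule card_mono[OF assms(2,1)])
  with assms(3) show ?thesis
    by (simp add: num_zeros_from_def)
qed

lemma dirichlet_series_eq_0_iff:
  assumes "sqrt_cancellation (\<lambda>k. x (Suc k))" "\<sigma> > 1/2"
  shows "dirichlet_series x \<sigma> = 0 \<longleftrightarrow> dirichlet_ext (\<lambda>k. x (Suc k)) (of_real \<sigma>) = 0"
proof -
  have "dirichlet_series x \<sigma> = Re (dirichlet_ext (\<lambda>k. x (Suc k)) (of_real \<sigma>))"
    using dirichlet_sums(1)[OF assms] unfolding dirichlet_series_def by (rule sums_unique[symmetric])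
  then have "dirichlet_ext (\<lambda>k. x (Suc k)) (of_real \<sigma>) = of_real (dirichlet_series x \<sigma>)"
    by (subst dirichlet_sums(2)[OF assms]) simp
  then show ?thesis
    by simp
qed

text \<open>Since 23/24 \<le> (15/16)(25/24), consecutive intervals of relative radius 1/24 overlap,
  and the least \<open>k\<close> whose left end is at most \<open>s\<close> works. At
  \<open>k = 0\<close> there is no upper restriction on \<open>s\<close>. Minimality is exported to
  bound the number of scales.\<close>

lemma ex_geometric_scale:
  fixes s :: real
  assumes "s > 0"
  obtains k :: nat where "(15/16) ^ k * (23/24) \<le> s" "k \<noteq> 0 \<Longrightarrow> s \<le> (15/16) ^ k * (25/24)"
    and "\<And>n. (15/16) ^ n * (23/24) \<le> s \<Longrightarrow> k \<le> n"
proof -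
  have "(\<lambda>k. (15/16::real) ^ k * (23/24)) \<longlonglongrightarrow> 0"
    by (intro tendsto_mult_left_zero LIMSEQ_realpow_zero) auto
  from order_tendstoD(2)[OF this assms] obtain k0 where "(15/16) ^ k0 * (23/24) < s"
    unfolding eventually_sequentially by blast
  then have k0: "(15/16) ^ k0 * (23/24) \<le> s"
    by (rule less_imp_le)
  define P where "P k \<longleftrightarrow> (15/16) ^ k * (23/24) \<le> s" for k :: nat
  have "\<exists>k. P k"
    using k0 unfolding P_def by (rule exI)
  then obtain k where k: "P k" "\<And>m. m < k \<Longrightarrow> \<not> P m"
    unfolding exists_least_iff[of P] by auto
  show thesis
  proof (rule that[of k])
    show "(15/16) ^ k * (23/24) \<le> s"
      using k(1) by (simp only: P_def)
    show "s \<le> (15/16) ^ k * (25/24)" if "k \<noteq> 0"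
    proof -
      obtain j where j: "k = Suc j"
        using \<open>k \<noteq> 0\<close> by (cases k) auto
      have "s < (15/16) ^ j * (23/24)"
        using k(2)[of j] j by (simp only: P_def not_le lessI)
      moreover have "(15/16::real) ^ j > 0"
        by simp
      moreover have "(15/16::real) ^ k = (15/16) * (15/16) ^ j"
        unfolding j by (rule power_Suc)
      ultimately show ?thesis
        by linarith
    qed
    show "k \<le> n" if "(15/16) ^ n * (23/24) \<le> s" for n
      using k(2)[of n] that unfolding P_def by linarith
  qed
qed

text \<open>Zeros to the right of scale \<open>k0\<close> form a fixed finite set \<open>E\<close>.
  Those between \<open>T\<close> and scale \<open>k0\<close> lie in O(L) intervals, L = ln (1 / (T -
  1/2)), each with O(ln L) zeros.\<close>

lemma num_zeros_upper:
  assumes sq: "sqrt_cancellation (\<lambda>k. x (Suc k))" and x0: "x 1 \<noteq> 0" and "k0 > 0"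
  assumes count: "\<And>k. k \<ge> k0 \<Longrightarrow> let Z = {\<sigma>. \<bar>\<sigma> - (1/2 + (15/16) ^ k)\<bar> \<le> (15/16) ^ k / 24 \<and>
        dirichlet_ext (\<lambda>k. x (Suc k)) (of_real \<sigma>) = 0} in finite Z \<and> real (card Z) \<le> 4 + 6 * ln (real k)"
  shows "\<exists>C. eventually (\<lambda>T. num_zeros_from (dirichlet_series x) T \<le>
      ereal (C * (ln (1 / (T - 1/2)) * ln (ln (1 / (T - 1/2)))))) (at_right (1/2))"
proof -
  let ?F = "dirichlet_ext (\<lambda>k. x (Suc k))"
  define Z where "Z k = {\<sigma>. \<bar>\<sigma> - (1/2 + (15/16) ^ k)\<bar> \<le> (15/16) ^ k / 24 \<and> ?F (of_real \<sigma>) = 0}" for k :: nat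
  define E where "E = {\<sigma>. 1/2 + (15/16) ^ k0 * (23/24) \<le> \<sigma> \<and> ?F (of_real \<sigma>) = 0}"
  have finE: "finite E"
    unfolding E_def using x0 by (intro finite_zeros_dirichlet_ext sq) auto
  have finZ: "finite (Z k)" and cardZ: "real (card (Z k)) \<le> 4 + 6 * ln (real k)" if "k \<ge> k0" for k
    using count[OF that] by (auto simp: Z_def Let_def)
  define C where "C = real (card E) + 17 * 118"
  have "eventually (\<lambda>T. ln (1 / (T - 1/2)) \<ge> exp 1) (at_right (1/2 :: real))"
    by real_asymp
  moreover have "eventually (\<lambda>T. T > 1/2) (at_right (1/2 :: real))"
    by (rule eventually_at_right_less)
  ultimately have "eventually (\<lambda>T. num_zeros_from (dirichlet_series x) T \<le>
      ereal (C * (ln (1 / (T - 1/2)) * ln (ln (1 / (T - 1/2)))))) (at_right (1/2))"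
  proof eventually_elim
    case (elim T)
    define \<tau> where "\<tau> = T - 1/2"
    define L where "L = ln (1 / \<tau>)"
    have "\<tau> > 0"
      using elim by (simp add: \<tau>_def)
    have L: "exp 1 \<le> L"
      using elim by (simp add: L_def \<tau>_def)
    then have L1: "1 \<le> L"
      using exp_ge_add_one_self[of 1] by linarith
    have lnL: "1 \<le> ln L"
      using L L1 by (subst ln_ge_iff) auto
    \<comment> \<open>Since ln (15/16) \<le> -1/16, this many scales reach down to
      \<open>\<tau>\<close>.\<close>
    define K where "K = nat \<lceil>16 * L\<rceil>"
    have K: "16 * L \<le> real K" "real K \<le> 17 * L"
      using L1 unfolding K_def by linarith+
    have "K > 0"
      using K L1 by linarith
    have "(15/16) ^ K * (23/24) \<le> \<tau>"
    proof -
      have "ln (15/16::real) \<le> 15/16 - 1"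
        by (intro ln_le_minus_one) auto
      then have "real K * ln (15/16) \<le> real K * (- (1/16))"
        by (intro mult_left_mono) auto
      also have "\<dots> \<le> - L"
        using K by simp
      also have "- L = ln \<tau>"
        using \<open>\<tau> > 0\<close> by (simp add: L_def ln_div)
      finally have "ln ((15/16) ^ K) \<le> ln \<tau>"
        by (simp add: ln_realpow)
      then have "(15/16) ^ K \<le> \<tau>"
        using \<open>\<tau> > 0\<close> by (subst (asm) ln_le_cancel_iff) auto
      moreover have "(15/16::real) ^ K > 0"
        by simp
      ultimately show ?thesis
        by linarith
    qed
    then have Kmax: "k \<le> K" if "\<And>n. (15/16) ^ n * (23/24) \<le> \<tau> \<Longrightarrow> k \<le> n" for k
      using that by blast
    have sub: "{\<sigma>. T \<le> \<sigma> \<and> dirichlet_series x \<sigma> = 0} \<subseteq> E \<union> (\<Union>k\<in>{k0..K}. Z k)"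
    proof safe
      fix \<sigma> assume \<sigma>: "T \<le> \<sigma>" "dirichlet_series x \<sigma> = 0" "\<sigma> \<notin> (\<Union>k\<in>{k0..K}. Z k)"
      have "\<sigma> > 1/2"
        using \<sigma>(1) elim by linarith
      then have F0: "?F (of_real \<sigma>) = 0"
        using \<sigma>(2) dirichlet_series_eq_0_iff[OF sq] by blast
      obtain k where k: "(15/16) ^ k * (23/24) \<le> \<sigma> - 1/2"
          "k \<noteq> 0 \<Longrightarrow> \<sigma> - 1/2 \<le> (15/16) ^ k * (25/24)"
          "\<And>n. (15/16) ^ n * (23/24) \<le> \<sigma> - 1/2 \<Longrightarrow> k \<le> n"
        using ex_geometric_scale[of "\<sigma> - 1/2"] \<open>\<sigma> > 1/2\<close> by auto
      show "\<sigma> \<in> E"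
      proof (cases "k \<le> k0")
        case True
        then have "(15/16::real) ^ k0 \<le> (15/16) ^ k"
          by (intro power_decreasing) auto
        with k(1) have "1/2 + (15/16) ^ k0 * (23/24) \<le> \<sigma>"
          by linarith
        then show ?thesis
          using F0 by (simp add: E_def)
      next
        case False
        have "k \<le> K"
          using \<sigma>(1) by (intro Kmax k(3)) (simp add: \<tau>_def)
        moreover have "\<bar>\<sigma> - (1/2 + (15/16) ^ k)\<bar> \<le> (15/16) ^ k / 24"
          using k(1) k(2) False by linarith
        then have "\<sigma> \<in> Z k"
          using F0 by (simp add: Z_def)
        ultimately show ?thesis
          using \<sigma>(3) False by auto
      qed
    qed
    have "ln (real K) \<le> ln (17 * L)"
      using K \<open>K > 0\<close> L1 by (subst ln_le_cancel_iff) auto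
    \<comment> \<open>Here ln 17 \<le> 16 \<le> 16 ln L, because
      \<open>L \<ge> exp 1\<close>.\<close>
    also have "\<dots> \<le> 18 * ln L"
      using ln_le_minus_one[of 17] L1 lnL by (simp add: ln_mult)
    finally have lnK: "ln (real K) \<le> 18 * ln L" .
    have "real (card (E \<union> (\<Union>k\<in>{k0..K}. Z k))) \<le> real (card E) + real (card (\<Union>k\<in>{k0..K}. Z k))"
      using card_Un_le by (metis of_nat_add of_nat_le_iff)
    also have "real (card (\<Union>k\<in>{k0..K}. Z k)) \<le> (\<Sum>k\<in>{k0..K}. real (card (Z k)))"
      using card_UN_le[of "{k0..K}" Z] by (simp flip: of_nat_sum)
    also have "\<dots> \<le> (\<Sum>k\<in>{k0..K}. 4 + 6 * ln (real K))"
      using \<open>k0 > 0\<close> by (intro sum_mono order_trans[OF cardZ]) auto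
    also have "\<dots> = real (card {k0..K}) * (4 + 6 * ln (real K))"
      by simp
    also have "\<dots> \<le> real K * (4 + 6 * ln (real K))"
      using \<open>k0 > 0\<close> \<open>K > 0\<close> by (intro mult_right_mono) (auto intro: add_nonneg_nonneg)
    also have "\<dots> \<le> (17 * L) * (4 * ln L + 6 * (18 * ln L))"
      using K lnK lnL L1 \<open>K > 0\<close> by (intro mult_mono) (auto intro: add_nonneg_nonneg)
    also have "real (card E) + (17 * L) * (4 * ln L + 6 * (18 * ln L)) = real (card E) * 1 + 17 * 112 * (L * ln L)"
      by (simp add: algebra_simps)
    also have "\<dots> \<le> real (card E) * (L * ln L) + 17 * 118 * (L * ln L)"
    proof -
      have "1 * 1 \<le> L * ln L"
        using L1 lnL by (intro mult_mono) auto
      then show ?thesis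
        by (intro add_mono mult_left_mono mult_right_mono) auto
    qed
    also have "\<dots> = C * (L * ln L)"
      by (simp add: C_def algebra_simps)
    finally have "real (card (E \<union> (\<Union>k\<in>{k0..K}. Z k))) \<le> C * (L * ln L)"
      by simp
    then show ?case
      using sub finE finZ unfolding L_def \<tau>_def
      by (intro num_zeros_from_le[of _ _ "E \<union> (\<Union>k\<in>{k0..K}. Z k)"]) auto
  qed
  then show ?thesis
    by blast
qed

section \<open>Almost sure bounds at the centres\<close>

context iid_normal
begin

text \<open>To exchange the quantifier over \<epsilon> with almost sure validity, only the values
  1/(m+1) are used; monotonicity in the exponent gives the rest.\<close>

lemma AE_sqrt_cancellation: "AE \<omega> in M. sqrt_cancellation (\<lambda>k. \<xi> k \<omega>)"
proof -
  have "AE \<omega> in M. \<forall>m. \<exists>C. \<forall>n. \<bar>\<Sum>k<n. \<xi> k \<omega>\<bar> \<le> C * real n powr (1/2 + 1 / real (Suc m))"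
    unfolding AE_all_countable using AE_partial_sums_powr by simp
  then show ?thesis
  proof eventually_elim
    case (elim \<omega>)
    show ?case
      unfolding sqrt_cancellation_def
    proof safe
      fix \<epsilon> :: real assume "\<epsilon> > 0"
      then obtain m where m: "1 / real (Suc m) < \<epsilon>"
        using nat_approx_posE by metis
      obtain C where C: "\<bar>\<Sum>k<n. \<xi> k \<omega>\<bar> \<le> C * real n powr (1/2 + 1 / real (Suc m))" for n
        using elim by blast
      have "C \<ge> 0"
        using C[of 1] by simp
      have "\<bar>\<Sum>k<n. \<xi> k \<omega>\<bar> \<le> C * real n powr (1/2 + \<epsilon>)" for n
      proof (cases "n = 0")
        case False
        then have "C * real n powr (1/2 + 1 / real (Suc m)) \<le> C * real n powr (1/2 + \<epsilon>)"
          using m \<open>C \<ge> 0\<close> by (intro mult_left_mono powr_mono) auto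
        with C[of n] show ?thesis
          by linarith
      qed auto
      then show "\<exists>C. \<forall>n. \<bar>\<Sum>k<n. \<xi> k \<omega>\<bar> \<le> C * real n powr (1/2 + \<epsilon>)"
        by blast
    qed
  qed
qed

text \<open>Small balls of arbitrarily small radius. For \<open>n = 0\<close> this makes the limit
  of the series at infinity nonzero.\<close>

lemma AE_nonzero: "AE \<omega> in M. \<xi> n \<omega> \<noteq> 0"
proof -
  have "prob {\<omega>\<in>space M. \<xi> n \<omega> = 0} \<le> \<epsilon>" if "\<epsilon> > 0" for \<epsilon>
  proof -
    have "prob {\<omega>\<in>space M. \<xi> n \<omega> = 0} \<le> prob {\<omega>\<in>space M. \<bar>\<xi> n \<omega>\<bar> < \<epsilon>}"
      using that by (intro finite_measure_mono) auto
    also have "\<dots> \<le> \<epsilon>"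
      by (rule std_normal_small_ball[OF distributed_\<xi> that])
    finally show ?thesis .
  qed
  then have "prob {\<omega>\<in>space M. \<xi> n \<omega> = 0} \<le> 0"
    by (rule field_le_epsilon) auto
  then have "prob {\<omega>\<in>space M. \<not> (\<xi> n \<omega> \<noteq> 0)} = 0"
    using measure_nonneg[of M] by (simp add: order_antisym)
  then show ?thesis
    by (subst AE_iff_measurable[OF _ refl]) (auto simp: emeasure_eq_measure)
qed

text \<open>The j-th scaled coefficient has variance at most 4^j 2/\<delta>, as
  \<open>\<delta> k \<le> 1\<close>. With threshold 4^j k sqrt(2/\<delta>), Chebyshev's inequality
  gives 4^(-j) / k^2, which can be summed over \<open>j\<close> for the union and then over
  \<open>k\<close> for Borel-Cantelli.\<close>

lemma AE_taylor_bounds: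
  defines "\<delta> \<equiv> \<lambda>k::nat. (15/16::real) ^ k"
  shows "AE \<omega> in M. eventually (\<lambda>k. \<forall>j. \<not> eventually (\<lambda>n. 4 ^ j * (real k * sqrt (2 / \<delta> k)) <
        \<bar>\<Sum>m<n. \<delta> k ^ j / fact j * ((- ln (real (Suc m))) ^ j * real (Suc m) powr (- (1/2 + \<delta> k))) * \<xi> m \<omega>\<bar>)
        sequentially) sequentially"
proof -
  define E where "E k j = {\<omega>\<in>space M. eventually (\<lambda>n. 4 ^ j * (real k * sqrt (2 / \<delta> k)) <
        \<bar>\<Sum>m<n. \<delta> k ^ j / fact j * ((- ln (real (Suc m))) ^ j * real (Suc m) powr (- (1/2 + \<delta> k))) * \<xi> m \<omega>\<bar>)
        sequentially}" for k j
  have \<delta>: "\<delta> k > 0" "\<delta> k \<le> 1" for k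
    by (auto simp: \<delta>_def power_le_one)
  have E [measurable]: "E k j \<in> events" for k j
    unfolding E_def by measurable
  have prob_E: "prob (E k j) \<le> 1 / real k ^ 2 * (1/4) ^ j" if "k \<ge> 1" for k j
  proof -
    have "prob (E k j) \<le> (4 ^ j * (2 / \<delta> k)) / (4 ^ j * (real k * sqrt (2 / \<delta> k)))\<^sup>2"
      unfolding E_def
    proof (rule prob_eventually_weighted_sum_gt)
      have "4 ^ j * (1 + 1 / \<delta> k) \<le> 4 ^ j * (2 / \<delta> k)"
        using \<delta>[of k] by (intro mult_left_mono) (auto simp: field_simps)
      then show "(\<Sum>m<n. (\<delta> k ^ j / fact j * ((- ln (real (Suc m))) ^ j * real (Suc m) powr (- (1/2 + \<delta> k))))\<^sup>2)
          \<le> 4 ^ j * (2 / \<delta> k)" for n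
        using sum_taylor_weights_le[OF \<delta>(1)] order_trans by blast
    qed (use \<delta>[of k] that in auto)
    also have "\<dots> = 1 / real k ^ 2 * (1/4) ^ j"
      using \<delta>[of k] that by (simp add: power_mult_distrib power2_eq_square power_one_over field_simps)
    finally show ?thesis .
  qed
  have prob_UN: "prob (\<Union>j. E k j) \<le> 1 / real k ^ 2 * (4/3)" if "k \<ge> 1" for k
  proof -
    have g: "(\<lambda>j. 1 / real k ^ 2 * (1/4::real) ^ j) sums (1 / real k ^ 2 * (4/3))"
      using sums_mult[OF geometric_sums[of "1/4::real"], of "1 / real k ^ 2"] by simp
    then have sum: "summable (\<lambda>j. prob (E k j))"
      using prob_E[OF that] by (intro summable_comparison_test'[of _ 0, OF sums_summable]) auto
    have "prob (\<Union>j. E k j) \<le> (\<Sum>j. prob (E k j))"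
      by (intro finite_measure_subadditive_countably sum) auto
    also have "\<dots> \<le> (\<Sum>j. 1 / real k ^ 2 * (1/4) ^ j)"
      by (intro suminf_le prob_E[OF that] sum sums_summable[OF g])
    also have "\<dots> = 1 / real k ^ 2 * (4/3)"
      using g by (simp add: sums_iff)
    finally show ?thesis .
  qed
  have "summable (\<lambda>k. prob (\<Union>j. E k j))"
  proof (rule summable_comparison_test'[where N=1])
    show "summable (\<lambda>k. 1 / real k ^ 2 * (4/3))"
      by (intro summable_mult2 inverse_power_summable[of 2, where 'a=real, unfolded inverse_eq_divide]) auto
  qed (use prob_UN in auto)
  then have "AE \<omega> in M. eventually (\<lambda>k. \<omega> \<in> space M - (\<Union>j. E k j)) sequentially"
    by (intro borel_cantelli_AE1) (auto simp: emeasure_eq_measure)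
  then show ?thesis
    by eventually_elim (auto simp: E_def elim: eventually_mono)
qed

text \<open>The standard deviation at the centre is at least 1 / (3 sqrt \<delta>), so the
  small-ball probability is at most 1/k^2, which is summable.\<close>

lemma AE_center_bound:
  defines "\<delta> \<equiv> \<lambda>k::nat. (15/16::real) ^ k"
  shows "AE \<omega> in M. eventually (\<lambda>k. \<not> eventually (\<lambda>n.
      \<bar>\<Sum>m<n. real (Suc m) powr (- (1/2 + \<delta> k)) * \<xi> m \<omega>\<bar> < 1 / (3 * sqrt (\<delta> k) * real k ^ 2)) sequentially) sequentially"
proof -
  define E where "E k = {\<omega>\<in>space M. eventually (\<lambda>n.
      \<bar>\<Sum>m<n. real (Suc m) powr (- (1/2 + \<delta> k)) * \<xi> m \<omega>\<bar> < 1 / (3 * sqrt (\<delta> k) * real k ^ 2)) sequentially}" for k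
  have \<delta>: "\<delta> k > 0" for k
    by (auto simp: \<delta>_def)
  have [measurable]: "E k \<in> events" for k
    unfolding E_def by measurable
  have prob_E: "prob (E k) \<le> 1 / real k ^ 2" if "k \<ge> 1" for k
  proof -
    obtain n where n: "(\<Sum>m<n. (real (Suc m) powr (- (1/2 + \<delta> k)))\<^sup>2) \<ge> 1 / (9 * \<delta> k)"
      using ex_sum_weights_ge[OF \<delta>] by blast
    have "prob (E k) \<le> 1 / (3 * sqrt (\<delta> k) * real k ^ 2) / sqrt (1 / (9 * \<delta> k))"
      unfolding E_def using \<delta>[of k] that by (intro prob_eventually_weighted_sum_lt[OF n]) auto
    also have "\<dots> = 1 / real k ^ 2"
      using \<delta>[of k] that by (simp add: real_sqrt_divide real_sqrt_mult field_simps)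
    finally show ?thesis .
  qed
  have "summable (\<lambda>k. prob (E k))"
  proof (rule summable_comparison_test'[where N=1])
    show "summable (\<lambda>k. 1 / real k ^ 2)"
      by (intro inverse_power_summable[of 2, where 'a=real, unfolded inverse_eq_divide]) auto
  qed (use prob_E in auto)
  then have "AE \<omega> in M. eventually (\<lambda>k. \<omega> \<in> space M - E k) sequentially"
    by (intro borel_cantelli_AE1) (auto simp: emeasure_eq_measure)
  then show ?thesis
    by eventually_elim (auto simp: E_def elim: eventually_mono)
qed

lemma AE_num_zeros_upper:
  assumes x: "\<And>k \<omega>. x \<omega> (Suc k) = \<xi> k \<omega>"
  shows "AE \<omega> in M. \<exists>C. eventually (\<lambda>T. num_zeros_from (dirichlet_series (x \<omega>)) T \<le>
      ereal (C * (ln (1 / (T - 1/2)) * ln (ln (1 / (T - 1/2)))))) (at_right (1/2))"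
  using AE_sqrt_cancellation AE_nonzero[of 0] AE_taylor_bounds AE_center_bound
proof eventually_elim
  case (elim \<omega>)
  have sq: "sqrt_cancellation (\<lambda>k. x \<omega> (Suc k))"
    using elim(1) by (simp add: x)
  obtain k0 where k0: "\<And>k. k \<ge> k0 \<Longrightarrow> \<forall>j. \<not> eventually (\<lambda>n. 4 ^ j * (real k * sqrt (2 / (15/16) ^ k)) <
        \<bar>\<Sum>m<n. ((15/16) ^ k) ^ j / fact j * ((- ln (real (Suc m))) ^ j * real (Suc m) powr (- (1/2 + (15/16) ^ k))) * \<xi> m \<omega>\<bar>)
        sequentially"
    using elim(3) unfolding eventually_sequentially[of "\<lambda>k. \<forall>j. _ k j"] by blast
  obtain k1 where k1: "\<And>k. k \<ge> k1 \<Longrightarrow> \<not> eventually (\<lambda>n.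
      \<bar>\<Sum>m<n. real (Suc m) powr (- (1/2 + (15/16) ^ k)) * \<xi> m \<omega>\<bar> < 1 / (3 * sqrt ((15/16) ^ k) * real k ^ 2)) sequentially"
    using elim(4) unfolding eventually_sequentially[of "\<lambda>k. \<not> _ k"] by blast
  show ?case
  proof (rule num_zeros_upper[OF sq])
    show "x \<omega> 1 \<noteq> 0"
      using elim(2) x[of \<omega> 0] by simp
    show "max 1 (max k0 k1) > 0"
      by simp
    fix k assume k: "k \<ge> max 1 (max k0 k1)"
    show "let Z = {\<sigma>. \<bar>\<sigma> - (1/2 + (15/16) ^ k)\<bar> \<le> (15/16) ^ k / 24 \<and>
        dirichlet_ext (\<lambda>k. x \<omega> (Suc k)) (of_real \<sigma>) = 0} in finite Z \<and> real (card Z) \<le> 4 + 6 * ln (real k)"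
      unfolding Let_def
      using card_zeros_near_center[OF sq, of "(15/16) ^ k" k] k k0[of k] k1[of k] by (auto simp: x)
  qed
qed

end

section \<open>Blocks\<close>

lemma num_zeros_from_ge:
  assumes "A \<subseteq> {\<sigma>. T \<le> \<sigma> \<and> f \<sigma> = 0}"
  shows "ereal (real (card A)) \<le> num_zeros_from f T"
  using assms card_mono by (auto simp: num_zeros_from_def)


lemma sum_inverse_Suc_le: "(\<Sum>m<p. 1 / real (Suc m)) \<le> 1 + ln (real (Suc p))"
proof -
  have "(\<Sum>m<Suc p. 1 / real (Suc m)) \<le> 1 + ln (real (Suc p))" for p
  proof (induction p)
    case (Suc p)
    have "ln (real (Suc p) / real (Suc (Suc p))) \<le> real (Suc p) / real (Suc (Suc p)) - 1"
      by (intro ln_le_minus_one) auto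
    then have "1 / real (Suc (Suc p)) \<le> ln (real (Suc (Suc p))) - ln (real (Suc p))"
      by (simp add: ln_div field_simps)
    with Suc show ?case
      by simp
  qed simp
  from this[of p] show ?thesis
    by (rule order_trans[rotated]) simp
qed

text \<open>In units of ln 2, block \<open>k\<close> covers logarithms from 2^(k^2-k) to 2^(k^2+k),
  since (k+1)^2 - (k+1) = k^2 + k. This leaves a factor 2^k on each side of 2^(k^2), the inverse of
  \<open>block_gap k\<close>, where the variance is concentrated.\<close>

definition block_start :: "nat \<Rightarrow> nat" where
  "block_start k = 2 ^ (2 ^ (k\<^sup>2 - k))"

text \<open>The shift by 1 reflects that position \<open>m\<close> stands for the term of index
  \<open>Suc m\<close>.\<close>

definition block :: "nat \<Rightarrow> nat set" where
  "block k = {block_start k - 1..<block_start (Suc k) - 1}"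

definition block_gap :: "nat \<Rightarrow> real" where
  "block_gap k = (1/2) ^ k\<^sup>2"

definition block_weight :: "nat \<Rightarrow> nat \<Rightarrow> real" where
  "block_weight k m = real (Suc m) powr (- (1/2 + block_gap k))"

definition block_variance :: "nat \<Rightarrow> real" where
  "block_variance k = (\<Sum>m\<in>block k. (block_weight k m)\<^sup>2)"

lemma block_gap_pos: "block_gap k > 0" and block_gap_le_1: "block_gap k \<le> 1"
  by (auto simp: block_gap_def power_le_one)

lemma block_gap_strict_antimono: "j < k \<Longrightarrow> block_gap k < block_gap j"
  unfolding block_gap_def by (intro power_strict_decreasing power_strict_mono) auto

lemma block_exponent_mono: "j \<le> k \<Longrightarrow> j\<^sup>2 - j \<le> k\<^sup>2 - (k::nat)"
proof (induction rule: dec_induct)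
  case (step n)
  have "n\<^sup>2 - n \<le> (Suc n)\<^sup>2 - Suc n"
    by (simp add: power2_eq_square)
  with step show ?case
    by linarith
qed auto

lemma block_start_mono: "j \<le> k \<Longrightarrow> block_start j \<le> block_start k"
  unfolding block_start_def by (intro power_increasing block_exponent_mono) auto

lemma block_start_pos: "block_start k > 0"
  by (simp add: block_start_def)

lemma disjoint_family_block: "disjoint_family block"
proof -
  have "block j \<inter> block k = {}" if "j < k" for j k
    using block_start_mono[of "Suc j" k] that by (auto simp: block_def)
  then show ?thesis
    unfolding disjoint_family_on_def by (metis inf_commute linorder_neq_iff)
qed

lemma block_weight_sq: "(block_weight k m)\<^sup>2 = real (Suc m) powr (- 1 - 2 * block_gap k)"
  by (simp add: block_weight_def power2_eq_square powr_add[symmetric] del: of_nat_Suc)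

text \<open>Only the indices up to 2^(2^(k^2)) are kept. There the factor n^(-2
  \<open>block_gap k\<close>) is at least 1/4, and the logarithmic length is at least half of
  2^(k^2) ln 2. Block 0 is empty, whence \<open>k \<ge> 1\<close>.\<close>

lemma block_variance_ge:
  assumes "k \<ge> 1"
  shows "block_variance k \<ge> 2 ^ k\<^sup>2 / 12"
proof -
  let ?\<delta> = "block_gap k"
  define p where "p = block_start k - 1"
  define q :: nat where "q = 2 ^ (2 ^ k\<^sup>2) - 1"
  have Suc_p: "Suc p = block_start k"
    using block_start_pos[of k] by (simp add: p_def)
  have Suc_q: "Suc q = 2 ^ (2 ^ k\<^sup>2)"
    by (simp add: q_def)
  have "block_start k \<le> 2 ^ (2 ^ k\<^sup>2)"
    unfolding block_start_def by (intro power_increasing) auto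
  then have "p \<le> q"
    using Suc_p Suc_q by linarith
  have "k\<^sup>2 \<le> (Suc k)\<^sup>2 - Suc k"
    by (simp add: power2_eq_square)
  then have q: "Suc q \<le> block_start (Suc k)"
    unfolding Suc_q block_start_def by (intro power_increasing) auto
  have ln_p: "ln (real (Suc p)) = 2 ^ (k\<^sup>2 - k) * ln 2"
    unfolding Suc_p block_start_def by (simp add: ln_realpow)
  have ln_q: "ln (real (Suc q)) = 2 ^ k\<^sup>2 * ln 2"
    unfolding Suc_q by (simp add: ln_realpow)
  have "q \<ge> 1"
  proof -
    have "(2::nat) ^ 1 \<le> 2 ^ (2 ^ k\<^sup>2)"
      by (intro power_increasing) auto
    with Suc_q show ?thesis
      by simp
  qed
  have "1 / 4 = real (Suc q) powr (- 2 * ?\<delta>)"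
  proof -
    have "real (Suc q) powr (- 2 * ?\<delta>) = exp (- 2 * ?\<delta> * (2 ^ k\<^sup>2 * ln 2))"
      unfolding powr_def ln_q by simp
    also have "- 2 * ?\<delta> * (2 ^ k\<^sup>2 * ln 2) = - ln (2 * 2)"
      by (subst ln_mult) (auto simp: block_gap_def power_one_over)
    also have "exp (- ln (2 * 2 :: real)) = 1 / 4"
      by (simp add: exp_minus)
    finally show ?thesis ..
  qed
  also have "\<dots> \<le> real q powr (- 2 * ?\<delta>)"
    using \<open>q \<ge> 1\<close> block_gap_pos[of k] by (intro powr_mono2') auto
  finally have quarter: "1 / 4 \<le> real q powr (- 2 * ?\<delta>)" .
  have "2 ^ k\<^sup>2 / 3 \<le> ln (real (Suc q)) - ln (real (Suc p))"
  proof -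
    have "k\<^sup>2 - k \<le> k\<^sup>2 - 1"
      using assms by simp
    then have "(2::real) ^ (k\<^sup>2 - k) \<le> 2 ^ (k\<^sup>2 - 1)"
      by (intro power_increasing) auto
    also have "\<dots> = 2 ^ k\<^sup>2 / 2"
      using assms by (simp add: power_diff)
    finally have "2 ^ k\<^sup>2 / 2 * ln 2 \<le> (2 ^ k\<^sup>2 - 2 ^ (k\<^sup>2 - k)) * ln (2::real)"
      by (intro mult_right_mono) auto
    moreover have "2 ^ k\<^sup>2 / 2 * (2/3) \<le> 2 ^ k\<^sup>2 / 2 * ln (2::real)"
      by (intro mult_left_mono ln2_ge_two_thirds) auto
    ultimately show ?thesis
      unfolding ln_p ln_q left_diff_distrib by linarith
  qed
  then have "1 / 4 * (2 ^ k\<^sup>2 / 3) \<le> real q powr (- 2 * ?\<delta>) * (ln (real (Suc q)) - ln (real (Suc p)))"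
    by (intro mult_mono quarter) auto
  also have "\<dots> \<le> (\<Sum>m\<in>{p..<q}. real (Suc m) powr (- 1 - 2 * ?\<delta>))"
    by (intro sum_powr_ge block_gap_pos \<open>p \<le> q\<close>)
  also have "\<dots> \<le> block_variance k"
    unfolding block_variance_def block_weight_sq block_def
    using q by (intro sum_mono2) (auto simp: p_def)
  finally show ?thesis
    by simp
qed

lemma block_variance_pos: "k \<ge> 1 \<Longrightarrow> block_variance k > 0"
  using block_variance_ge[of k] by (rule less_le_trans[rotated]) auto

text \<open>Below the block the squared weights are at most 1/n, with harmonic sum of order ln
  u\<le> 2^(k^2-k) for u = \<open>block_start k\<close>. Above it, half of the extra decay gives a
  factor at most 2^(-k), and the other half leaves a convergent sum of order 2^(k^2).\<close>

lemma block_remainder_le: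
  assumes "k \<ge> 1"
  shows "(\<Sum>m<n. (if m \<in> block k then 0 else block_weight k m)\<^sup>2) \<le> 4 * 2 ^ k\<^sup>2 / 2 ^ k"
proof -
  let ?\<delta> = "block_gap k" and ?u = "block_start (Suc k)"
  define p where "p = block_start k - 1"
  have Suc_p: "Suc p = block_start k"
    using block_start_pos[of k] by (simp add: p_def)
  have kk: "k \<le> k\<^sup>2"
    by (simp add: power2_eq_square)
  have "(if m \<in> block k then 0 else block_weight k m)\<^sup>2 \<le>
      (if m < p then 1 / real (Suc m) else 0) + real ?u powr (- ?\<delta>) * real (Suc m) powr (- 1 - ?\<delta>)" for m
  proof -
    consider "m \<in> block k" | "m < p" | "m \<ge> ?u - 1"
      unfolding block_def p_def atLeastLessThan_iff by linarith
    then show ?thesis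
    proof cases
      case 2
      have "real (Suc m) powr (- 1 - 2 * ?\<delta>) \<le> real (Suc m) powr - 1"
        using block_gap_pos[of k] by (intro powr_mono) auto
      also have "\<dots> = 1 / real (Suc m)"
        by (simp add: powr_minus_divide del: of_nat_Suc)
      finally have "real (Suc m) powr (- 1 - 2 * ?\<delta>) \<le> 1 / real (Suc m)" .
      moreover have "0 \<le> real ?u powr (- ?\<delta>) * real (Suc m) powr (- 1 - ?\<delta>)"
        by simp
      ultimately have "real (Suc m) powr (- 1 - 2 * ?\<delta>)
          \<le> 1 / real (Suc m) + real ?u powr (- ?\<delta>) * real (Suc m) powr (- 1 - ?\<delta>)"
        by linarith
      moreover have "(if m \<in> block k then 0 else block_weight k m)\<^sup>2 \<le> real (Suc m) powr (- 1 - 2 * ?\<delta>)"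
        by (simp add: block_weight_sq del: of_nat_Suc)
      ultimately show ?thesis
        using 2 by (simp del: of_nat_Suc)
    next
      case 3
      have "real (Suc m) powr (- 1 - 2 * ?\<delta>) = real (Suc m) powr (- ?\<delta>) * real (Suc m) powr (- 1 - ?\<delta>)"
        unfolding powr_add[symmetric] by (simp add: algebra_simps del: of_nat_Suc)
      also have "\<dots> \<le> real ?u powr (- ?\<delta>) * real (Suc m) powr (- 1 - ?\<delta>)"
        using 3 block_gap_pos[of k] block_start_pos[of "Suc k"]
        by (intro mult_right_mono powr_mono2') auto
      finally show ?thesis
        by (auto simp: block_weight_sq simp del: of_nat_Suc intro: add_increasing)
    qed (simp add: add_nonneg_nonneg)
  qed
  then have "(\<Sum>m<n. (if m \<in> block k then 0 else block_weight k m)\<^sup>2) \<le>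
      (\<Sum>m<n. (if m < p then 1 / real (Suc m) else 0) + real ?u powr (- ?\<delta>) * real (Suc m) powr (- 1 - ?\<delta>))"
    by (rule sum_mono)
  also have "\<dots> = (\<Sum>m<n. if m < p then 1 / real (Suc m) else 0)
      + real ?u powr (- ?\<delta>) * (\<Sum>m<n. real (Suc m) powr (- 1 - ?\<delta>))"
    by (simp add: sum.distrib sum_distrib_left)
  also have "(\<Sum>m<n. if m < p then 1 / real (Suc m) else 0) \<le> (\<Sum>m<p. 1 / real (Suc m))"
    by (subst sum.inter_filter[symmetric]) (auto intro!: sum_mono2)
  also have "\<dots> \<le> 1 + ln (real (Suc p))"
    by (rule sum_inverse_Suc_le)
  also have "\<dots> \<le> 2 * (2 ^ k\<^sup>2 / 2 ^ k)"
  proof -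
    have "ln (real (Suc p)) = 2 ^ (k\<^sup>2 - k) * ln 2"
      unfolding Suc_p block_start_def by (simp add: ln_realpow)
    also have "\<dots> \<le> 2 ^ (k\<^sup>2 - k) * 1"
      using ln_2_less_1 by (intro mult_left_mono) auto
    finally have "1 + ln (real (Suc p)) \<le> 2 * 2 ^ (k\<^sup>2 - k)"
      using one_le_power[of "2::real" "k\<^sup>2 - k"] by linarith
    then show ?thesis
      using kk by (simp add: power_diff)
  qed
  also have "real ?u powr (- ?\<delta>) * (\<Sum>m<n. real (Suc m) powr (- 1 - ?\<delta>)) \<le> (1 / 2 ^ k) * (2 * 2 ^ k\<^sup>2)"
  proof (intro mult_mono)
    have "(Suc k)\<^sup>2 - Suc k = k\<^sup>2 + k"
      by (simp add: power2_eq_square)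
    then have "real ?u powr (- ?\<delta>) = exp (- ?\<delta> * (2 ^ (k\<^sup>2 + k) * ln 2))"
      unfolding powr_def block_start_def by (simp add: ln_realpow)
    also have "- ?\<delta> * (2 ^ (k\<^sup>2 + k) * ln 2) = - (2 ^ k * ln 2)"
      by (simp add: block_gap_def power_one_over power_add)
    \<comment> \<open>The true decay is doubly exponential; \<open>k \<le> 2 ^ k\<close> reduces it
      to the rate of the lower part.\<close>
    also have "- (2 ^ k * ln 2) \<le> - (real k * ln 2)"
      using of_nat_less_two_power[of k, where 'a=real] by (simp add: mult_right_mono)
    also have "exp (- (real k * ln 2)) = 1 / 2 ^ k"
      by (simp add: exp_minus exp_of_nat_mult divide_inverse)
    finally show "real ?u powr (- ?\<delta>) \<le> 1 / 2 ^ k"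
      by simp
    have "(\<Sum>m<n. real (Suc m) powr (- 1 - ?\<delta>)) \<le> 1 + 1 / ?\<delta>"
      by (intro sum_powr_le block_gap_pos)
    also have "\<dots> \<le> 2 * 2 ^ k\<^sup>2"
      by (simp add: block_gap_def power_one_over)
    finally show "(\<Sum>m<n. real (Suc m) powr (- 1 - ?\<delta>)) \<le> 2 * 2 ^ k\<^sup>2" .
  qed (auto intro: sum_nonneg)
  finally show ?thesis
    by (simp add: field_simps)
qed

text \<open>Once \<open>n\<close> passes the end of the block, the partial sum without the block is
  the full partial sum minus the block sum. Its limit cannot exceed \<open>V\<close> in absolute
  value, or \<open>small\<close> would fail.\<close>

lemma dirichlet_ext_minus_block:
  assumes x: "sqrt_cancellation x"
    and small: "\<not> eventually (\<lambda>n. V < \<bar>\<Sum>m<n. (if m \<in> block k then 0 else block_weight k m) * x m\<bar>) sequentially"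
  shows "\<bar>Re (dirichlet_ext x (of_real (1/2 + block_gap k))) - (\<Sum>m\<in>block k. block_weight k m * x m)\<bar> \<le> V"
proof (rule ccontr)
  let ?F = "Re (dirichlet_ext x (of_real (1/2 + block_gap k)))" and ?B = "\<Sum>m\<in>block k. block_weight k m * x m"
  assume "\<not> ?thesis"
  moreover have "(\<lambda>n. \<bar>(\<Sum>m<n. block_weight k m * x m) - ?B\<bar>) \<longlonglongrightarrow> \<bar>?F - ?B\<bar>"
    using dirichlet_sums(1)[OF x, of "1/2 + block_gap k"] block_gap_pos[of k]
    by (intro tendsto_intros) (simp add: sums_def block_weight_def mult.commute)
  ultimately have "eventually (\<lambda>n. V < \<bar>(\<Sum>m<n. block_weight k m * x m) - ?B\<bar>) sequentially"
    by (simp add: order_tendstoD(1))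
  moreover have "eventually (\<lambda>n. n \<ge> block_start (Suc k)) sequentially"
    by (rule eventually_ge_at_top)
  ultimately have "eventually (\<lambda>n. V < \<bar>\<Sum>m<n. (if m \<in> block k then 0 else block_weight k m) * x m\<bar>) sequentially"
  proof eventually_elim
    case (elim n)
    have "block k \<subseteq> {..<n}"
      using elim(2) by (auto simp: block_def)
    then have "(\<Sum>m<n. block_weight k m * x m) - ?B = (\<Sum>m\<in>{..<n} - block k. block_weight k m * x m)"
      by (simp add: sum_diff)
    also have "\<dots> = (\<Sum>m<n. (if m \<in> block k then 0 else block_weight k m) * x m)"
      by (intro sum.mono_neutral_cong_left) auto
    finally show ?case
      using elim(1) by simp
  qed
  with small show False ..
qed

section \<open>Sign changes and the lower bound\<close>

text \<open>The intermediate value theorem for the real part, which is the whole function on the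
  real axis. The endpoints are excluded to keep zeros from different pairs apart.\<close>

lemma zero_between_block_points:
  assumes x: "sqrt_cancellation x"
    and pos: "Re (dirichlet_ext x (of_real (1/2 + block_gap j))) > 0"
    and neg: "Re (dirichlet_ext x (of_real (1/2 + block_gap (Suc j)))) < 0"
  shows "\<exists>\<sigma>. 1/2 + block_gap (Suc j) < \<sigma> \<and> \<sigma> < 1/2 + block_gap j \<and> dirichlet_ext x (of_real \<sigma>) = 0"
proof -
  let ?f = "\<lambda>\<sigma>. Re (dirichlet_ext x (of_real \<sigma>))"
  have le: "1/2 + block_gap (Suc j) \<le> 1/2 + block_gap j"
    using block_gap_strict_antimono[of j "Suc j"] by simp
  have "continuous_on {z. Re z > 1/2} (dirichlet_ext x)"
    by (intro holomorphic_on_imp_continuous_on holomorphic_dirichlet_ext x)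
  then have "continuous_on {1/2 + block_gap (Suc j)..1/2 + block_gap j} (\<lambda>\<sigma>. dirichlet_ext x (of_real \<sigma>))"
  proof (rule continuous_on_compose2)
    show "of_real ` {1/2 + block_gap (Suc j)..1/2 + block_gap j} \<subseteq> {z::complex. Re z > 1/2}"
    proof safe
      fix \<sigma> assume "\<sigma> \<in> {1/2 + block_gap (Suc j)..1/2 + block_gap j}"
      then have "\<sigma> \<ge> 1/2 + block_gap (Suc j)"
        by simp
      with block_gap_pos[of "Suc j"] show "Re (of_real \<sigma>) > 1/2"
        unfolding Re_complex_of_real by linarith
    qed
  qed (intro continuous_intros)
  then have "continuous_on {1/2 + block_gap (Suc j)..1/2 + block_gap j} ?f"
    by (rule continuous_on_Re)
  from IVT'[OF less_imp_le[OF neg] less_imp_le[OF pos] le this]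
  obtain \<sigma> where \<sigma>: "1/2 + block_gap (Suc j) \<le> \<sigma>" "\<sigma> \<le> 1/2 + block_gap j" "?f \<sigma> = 0"
    by blast
  have "\<sigma> \<noteq> 1/2 + block_gap (Suc j)" "\<sigma> \<noteq> 1/2 + block_gap j"
    using pos neg \<sigma>(3) by force+
  then have "1/2 + block_gap (Suc j) < \<sigma>" "\<sigma> < 1/2 + block_gap j"
    using \<sigma>(1,2) by linarith+
  moreover have "dirichlet_ext x (of_real \<sigma>) = 0"
  proof -
    have "\<sigma> > 1/2"
      using \<sigma>(1) block_gap_pos[of "Suc j"] by linarith
    from dirichlet_sums(2)[OF x this] show ?thesis
      unfolding \<sigma>(3) by simp
  qed
  ultimately show ?thesis
    by blast
qed

text \<open>The pairs \<open>(2 * i + 1, 2 * i + 2)\<close> bound disjoint intervals moving towards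
  1/2 as \<open>i\<close> grows, so the chosen zeros are distinct.\<close>

lemma num_zeros_from_ge_sign_changes:
  assumes sq: "sqrt_cancellation (\<lambda>k. x (Suc k))"
    and I: "\<And>i. i \<in> I \<Longrightarrow> i < n \<and>
      Re (dirichlet_ext (\<lambda>k. x (Suc k)) (of_real (1/2 + block_gap (2 * i + 1)))) > 0 \<and>
      Re (dirichlet_ext (\<lambda>k. x (Suc k)) (of_real (1/2 + block_gap (2 * i + 2)))) < 0"
    and T: "1/2 < T" "T \<le> 1/2 + block_gap (2 * n)"
  shows "ereal (real (card I)) \<le> num_zeros_from (dirichlet_series x) T"
proof -
  let ?F = "dirichlet_ext (\<lambda>k. x (Suc k))"
  have "\<exists>\<sigma>. 1/2 + block_gap (2 * i + 2) < \<sigma> \<and> \<sigma> < 1/2 + block_gap (2 * i + 1) \<and> ?F (of_real \<sigma>) = 0"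
    if "i \<in> I" for i
    using zero_between_block_points[OF sq, of "2 * i + 1"] I[OF that] by auto
  then obtain z where z: "\<And>i. i \<in> I \<Longrightarrow>
      1/2 + block_gap (2 * i + 2) < z i \<and> z i < 1/2 + block_gap (2 * i + 1) \<and> ?F (of_real (z i)) = 0"
    by metis
  have mono: "block_gap k \<le> block_gap j" if "j \<le> k" for j k
    using block_gap_strict_antimono[of j k] that by (cases "j = k") auto
  have less: "z j < z i" if "i \<in> I" "j \<in> I" "i < j" for i j
    using z[OF that(1)] z[OF that(2)] mono[of "2 * i + 2" "2 * j + 1"] that(3) by simp
  have "inj_on z I"
  proof (rule inj_onI)
    fix i j assume "i \<in> I" "j \<in> I" "z i = z j"
    then show "i = j"
      using less[of i j] less[of j i] by (metis less_irrefl linorder_neqE_nat)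
  qed
  moreover have "z ` I \<subseteq> {\<sigma>. T \<le> \<sigma> \<and> dirichlet_series x \<sigma> = 0}"
  proof safe
    fix i assume i: "i \<in> I"
    show "T \<le> z i"
      using T z[OF i] I[OF i] mono[of "2 * i + 2" "2 * n"] by simp
    then show "dirichlet_series x (z i) = 0"
      using dirichlet_series_eq_0_iff[OF sq, of "z i"] z[OF i] T by simp
  qed
  ultimately show ?thesis
    using num_zeros_from_ge[of "z ` I" T] by (simp add: card_image)
qed

text \<open>Since \<open>block_gap (2 * n)\<close> is 2^(-(2n)^2), about sqrt L / 2 pairs lie to the
  right of \<open>T\<close>, where L = ln (1 / (T - 1/2)). The constant \<open>C\<close> absorbs
  finitely many lost pairs.\<close>

lemma num_zeros_lower:
  assumes sq: "sqrt_cancellation (\<lambda>k. x (Suc k))" and "c > 0"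
    and count: "\<And>n. n \<ge> n0 \<Longrightarrow> \<exists>I. real (card I) \<ge> c * real n - C \<and> (\<forall>i\<in>I. i < n \<and>
      Re (dirichlet_ext (\<lambda>k. x (Suc k)) (of_real (1/2 + block_gap (2 * i + 1)))) > 0 \<and>
      Re (dirichlet_ext (\<lambda>k. x (Suc k)) (of_real (1/2 + block_gap (2 * i + 2)))) < 0)"
  shows "eventually (\<lambda>T. ereal (c * (sqrt (ln (1 / (T - 1/2))) / 2 - 1) - C)
      \<le> num_zeros_from (dirichlet_series x) T) (at_right (1/2))"
proof -
  have "filterlim (\<lambda>T::real. ln (1 / (T - 1/2))) at_top (at_right (1/2))"
    by real_asymp
  then have "eventually (\<lambda>T. ln (1 / (T - 1/2)) \<ge> 4 * (real n0 + 1)\<^sup>2) (at_right (1/2 :: real))"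
    unfolding filterlim_at_top by blast
  moreover have "eventually (\<lambda>T. T > 1/2) (at_right (1/2 :: real))"
    by (rule eventually_at_right_less)
  ultimately show ?thesis
  proof eventually_elim
    case (elim T)
    define L where "L = ln (1 / (T - 1/2))"
    \<comment> \<open>Then (2n)^2 \<le> L, and ln 2 < 1 gives T - 1/2 = exp(-L) \<le>
      2^(-(2n)^2).\<close>
    define n where "n = nat \<lfloor>sqrt L / 2\<rfloor>"
    have "sqrt L \<ge> sqrt (4 * (real n0 + 1)\<^sup>2)"
      using elim by (simp add: L_def)
    then have L: "sqrt L \<ge> 2 * (real n0 + 1)"
      by (simp add: real_sqrt_mult)
    then have "sqrt L \<ge> 0"
      by (rule order_trans[rotated]) simp
    then have L0: "L \<ge> 0"
      by simp
    have n: "real n \<le> sqrt L / 2"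
      unfolding n_def using \<open>sqrt L \<ge> 0\<close> by (intro of_nat_floor) simp
    have n': "sqrt L / 2 - 1 \<le> real n"
      unfolding n_def by linarith
    with L have "real n0 \<le> real n"
      by argo
    then have "n \<ge> n0"
      by simp
    have "(2 * real n)\<^sup>2 \<le> (sqrt L)\<^sup>2"
      using n by (intro power_mono) auto
    then have n2: "real ((2 * n)\<^sup>2) \<le> L"
      using L0 by simp
    have "T - 1/2 > 0"
      using elim(2) by simp
    then have "L = - ln (T - 1/2)"
      unfolding L_def by (subst ln_div) auto
    then have "T - 1/2 = exp (- L)"
      using \<open>T - 1/2 > 0\<close> by simp
    also have "\<dots> \<le> exp (- (real ((2 * n)\<^sup>2) * ln 2))"
    proof -
      have "real ((2 * n)\<^sup>2) * ln 2 \<le> real ((2 * n)\<^sup>2) * 1"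
        using ln_2_less_1 by (intro mult_left_mono) auto
      then show ?thesis
        using n2 by simp
    qed
    also have "\<dots> = block_gap (2 * n)"
      unfolding block_gap_def by (subst exp_minus, subst exp_of_nat_mult) (simp add: power_one_over inverse_eq_divide)
    finally have T: "T \<le> 1/2 + block_gap (2 * n)"
      by simp
    obtain I where I: "real (card I) \<ge> c * real n - C" "\<forall>i\<in>I. i < n \<and>
      Re (dirichlet_ext (\<lambda>k. x (Suc k)) (of_real (1/2 + block_gap (2 * i + 1)))) > 0 \<and>
      Re (dirichlet_ext (\<lambda>k. x (Suc k)) (of_real (1/2 + block_gap (2 * i + 2)))) < 0"
      using count[OF \<open>n \<ge> n0\<close>] by blast
    have "c * (sqrt L / 2 - 1) \<le> c * real n"
      using \<open>c > 0\<close> n' by (intro mult_left_mono) auto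
    then have "ereal (c * (sqrt L / 2 - 1) - C) \<le> ereal (real (card I))"
      using I(1) by simp
    also have "\<dots> \<le> num_zeros_from (dirichlet_series x) T"
      by (rule num_zeros_from_ge_sign_changes[OF sq _ elim(2) T]) (use I(2) in blast)
    finally show ?case
      unfolding L_def .
  qed
qed

section \<open>Independence and frequency of sign changes\<close>

context iid_normal
begin

definition block_sum :: "nat \<Rightarrow> 'a \<Rightarrow> real" where
  "block_sum k \<omega> = (\<Sum>m\<in>block k. block_weight k m * \<xi> m \<omega>)"

text \<open>The strict margin of one standard deviation lets the sign survive a remainder of at most
  that size.\<close>

definition sign_change :: "nat \<Rightarrow> 'a \<Rightarrow> bool" where
  "sign_change i \<omega> \<longleftrightarrow> block_sum (2 * i + 1) \<omega> > sqrt (block_variance (2 * i + 1)) \<and>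
     block_sum (2 * i + 2) \<omega> < - sqrt (block_variance (2 * i + 2))"

lemma measurable_block_sum [measurable]: "block_sum k \<in> borel_measurable M"
  unfolding block_sum_def[abs_def] by measurable

lemma measurable_sign_change [measurable]: "Measurable.pred M (sign_change i)"
  unfolding sign_change_def[abs_def] by measurable

lemma indep_vars_block_sum: "indep_vars (\<lambda>_. borel) block_sum UNIV"
proof -
  have "indep_vars (\<lambda>j. PiM (block j) (\<lambda>_. borel)) (\<lambda>j \<omega>. restrict (\<lambda>m. \<xi> m \<omega>) (block j)) UNIV"
    by (intro indep_vars_restrict[OF indep_\<xi>] disjoint_family_block) auto
  then have "indep_vars (\<lambda>_. borel)
      (\<lambda>j \<omega>. (\<lambda>f. \<Sum>m\<in>block j. block_weight j m * f m) (restrict (\<lambda>m. \<xi> m \<omega>) (block j))) UNIV"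
    by (rule indep_vars_compose2) measurable
  then show ?thesis
    by (simp add: block_sum_def[abs_def])
qed

text \<open>Distinct \<open>i\<close> use disjoint pairs of block sums. The indicators are
  real-valued to suit Hoeffding's inequality.\<close>

lemma indep_vars_sign_change:
  "indep_vars (\<lambda>_. borel) (\<lambda>i \<omega>. of_bool (sign_change i \<omega>) :: real) UNIV"
proof -
  let ?K = "\<lambda>i::nat. {2 * i + 1, 2 * i + 2}"
  let ?Y = "\<lambda>i f. of_bool (f (2 * i + 1) > sqrt (block_variance (2 * i + 1)) \<and>
     f (2 * i + 2) < - sqrt (block_variance (2 * i + 2))) :: real"
  have "indep_vars (\<lambda>j. PiM (?K j) (\<lambda>_. borel)) (\<lambda>j \<omega>. restrict (\<lambda>m. block_sum m \<omega>) (?K j)) UNIV"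
    by (intro indep_vars_restrict[OF indep_vars_block_sum]) (auto simp: disjoint_family_on_def)
  then have "indep_vars (\<lambda>_. borel) (\<lambda>i \<omega>. ?Y i (restrict (\<lambda>m. block_sum m \<omega>) (?K i))) UNIV"
    by (rule indep_vars_compose2) measurable
  then show ?thesis
    by (simp add: sign_change_def)
qed

lemma prob_sign_change: "prob {\<omega>\<in>space M. sign_change i \<omega>} = std_normal_upper_tail\<^sup>2"
proof -
  have d: "distributed M lborel (\<lambda>\<omega>. block_sum k \<omega> / sqrt (block_variance k)) std_normal_density" if "k \<ge> 1" for k
    using distributed_weighted_sum[of "block k" "block_weight k"] block_variance_pos[OF that]
    by (simp add: block_sum_def block_variance_def block_def)
  have gt: "prob {\<omega>\<in>space M. sqrt (block_variance k) < block_sum k \<omega>} = std_normal_upper_tail"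
    and lt: "prob {\<omega>\<in>space M. block_sum k \<omega> < - sqrt (block_variance k)} = std_normal_upper_tail"
    if "k \<ge> 1" for k
    using prob_std_normal_gt_1[OF d[OF that]] prob_std_normal_lt_m1[OF d[OF that]] block_variance_pos[OF that]
    by (auto simp: pos_less_divide_eq pos_divide_less_eq)
  let ?a = "2 * i + 1" and ?b = "2 * i + 2"
  \<comment> \<open>Only \<open>?a\<close> and \<open>?b\<close> are ever inserted, so the second
    branch belongs to \<open>?b\<close>.\<close>
  define A where "A k = (if k = ?a then {sqrt (block_variance ?a)<..} else {..<- sqrt (block_variance ?b)})" for k
  have "prob (\<Inter>k\<in>{?a, ?b}. block_sum k -` A k \<inter> space M) = (\<Prod>k\<in>{?a, ?b}. prob (block_sum k -` A k \<inter> space M))"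
    by (intro indep_varsD[OF indep_vars_block_sum]) (auto simp: A_def)
  also have "(\<Inter>k\<in>{?a, ?b}. block_sum k -` A k \<inter> space M) = {\<omega>\<in>space M. sign_change i \<omega>}"
    by (auto simp: A_def sign_change_def)
  also have "(\<Prod>k\<in>{?a, ?b}. prob (block_sum k -` A k \<inter> space M))
      = prob (block_sum ?a -` A ?a \<inter> space M) * prob (block_sum ?b -` A ?b \<inter> space M)"
    by simp
  also have "block_sum ?a -` A ?a \<inter> space M = {\<omega>\<in>space M. sqrt (block_variance ?a) < block_sum ?a \<omega>}"
    by (auto simp: A_def)
  also have "block_sum ?b -` A ?b \<inter> space M = {\<omega>\<in>space M. block_sum ?b \<omega> < - sqrt (block_variance ?b)}"
    by (auto simp: A_def)
  finally show ?thesis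
    using gt[of ?a] lt[of ?b] by (simp add: power2_eq_square)
qed

text \<open>The indicators are independent with the same mean p. By Hoeffding's inequality fewer
  than half the expected number occur with probability at most exp(-p^2/2)^n, a summable geometric
  sequence.\<close>

lemma AE_many_sign_changes:
  "AE \<omega> in M. eventually (\<lambda>n. real (card {i. i < n \<and> sign_change i \<omega>}) > std_normal_upper_tail\<^sup>2 / 2 * real n) sequentially"
proof -
  define p where "p = std_normal_upper_tail\<^sup>2"
  have "p > 0"
    using std_normal_upper_tail_pos by (simp add: p_def)
  define E where "E n = {\<omega>\<in>space M. (\<Sum>i<n. of_bool (sign_change i \<omega>)) \<le> p / 2 * real n}" for n
  have [measurable]: "E n \<in> events" for n
    unfolding E_def by measurable
  have prob_E: "prob (E n) \<le> exp (- (p\<^sup>2 / 2)) ^ n" if "n \<ge> 1" for n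
  proof -
    let ?X = "\<lambda>i \<omega>. of_bool (sign_change i \<omega>) :: real"
    interpret H: Hoeffding_ineq M "{..<n}" ?X "\<lambda>_. 0" "\<lambda>_. 1" "\<Sum>i<n. expectation (?X i)"
    proof unfold_locales
      show "indep_vars (\<lambda>_. borel) ?X {..<n}"
        by (rule indep_vars_subset[OF indep_vars_sign_change]) auto
    qed auto
    have "expectation (?X i) = p" for i
    proof -
      have "expectation (?X i) = expectation (indicator {\<omega>\<in>space M. sign_change i \<omega>})"
        by (intro Bochner_Integration.integral_cong) (auto simp: indicator_def)
      also have "\<dots> = p"
        using prob_sign_change[of i] by (simp add: p_def)
      finally show ?thesis .
    qed
    then have "prob {\<omega>\<in>space M. (\<Sum>i<n. ?X i \<omega>) \<le> real n * p - p / 2 * real n}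
        \<le> exp (- 2 * (p / 2 * real n)\<^sup>2 / real n)"
      using H.Hoeffding_ineq_le[of "p / 2 * real n"] \<open>p > 0\<close> that by simp
    also have "- 2 * (p / 2 * real n)\<^sup>2 / real n = real n * (- (p\<^sup>2 / 2))"
      using that by (simp add: power2_eq_square)
    also have "exp (real n * (- (p\<^sup>2 / 2))) = exp (- (p\<^sup>2 / 2)) ^ n"
      by (rule exp_of_nat_mult)
    also have "real n * p - p / 2 * real n = p / 2 * real n"
      by simp
    finally show ?thesis
      by (simp add: E_def)
  qed
  have "summable (\<lambda>n. prob (E n))"
  proof (rule summable_comparison_test'[where N=1])
    show "summable (\<lambda>n. exp (- (p\<^sup>2 / 2)) ^ n)"
      using \<open>p > 0\<close> by (intro summable_geometric) simp
  qed (use prob_E in auto)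
  then have "AE \<omega> in M. eventually (\<lambda>n. \<omega> \<in> space M - E n) sequentially"
    by (intro borel_cantelli_AE1) (auto simp: emeasure_eq_measure)
  then show ?thesis
  proof eventually_elim
    case (elim \<omega>)
    then show ?case
    proof eventually_elim
      case (elim n)
      have "(\<Sum>i<n. of_bool (sign_change i \<omega>) :: real) = real (card {i. i < n \<and> sign_change i \<omega>})"
        by (simp add: of_bool_def sum.If_cases Int_def)
      then show ?case
        using elim by (auto simp: E_def p_def not_le)
    qed
  qed
qed

text \<open>The remainder has at most 48 / 2^k times the variance of the block, so by Chebyshev's
  inequality it exceeds the block's standard deviation with summable probability.\<close>

lemma AE_block_remainder:
  "AE \<omega> in M. eventually (\<lambda>k. \<not> eventually (\<lambda>n. sqrt (block_variance k) <
      \<bar>\<Sum>m<n. (if m \<in> block k then 0 else block_weight k m) * \<xi> m \<omega>\<bar>) sequentially) sequentially"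
proof -
  define E where "E k = {\<omega>\<in>space M. eventually (\<lambda>n. sqrt (block_variance k) <
      \<bar>\<Sum>m<n. (if m \<in> block k then 0 else block_weight k m) * \<xi> m \<omega>\<bar>) sequentially}" for k
  have [measurable]: "E k \<in> events" for k
    unfolding E_def by measurable
  have prob_E: "prob (E k) \<le> 48 * (1/2) ^ k" if "k \<ge> 1" for k
  proof -
    have "prob (E k) \<le> (4 * 2 ^ k\<^sup>2 / 2 ^ k) / (sqrt (block_variance k))\<^sup>2"
      unfolding E_def using block_remainder_le[OF that] block_variance_pos[OF that]
      by (intro prob_eventually_weighted_sum_gt) auto
    also have "\<dots> = (4 * 2 ^ k\<^sup>2 / 2 ^ k) / block_variance k"
      using block_variance_pos[OF that] by simp
    also have "\<dots> \<le> (4 * 2 ^ k\<^sup>2 / 2 ^ k) / (2 ^ k\<^sup>2 / 12)"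
      using block_variance_ge[OF that] by (intro divide_left_mono mult_pos_pos) (auto intro: block_variance_pos that)
    also have "\<dots> = 48 * (1/2) ^ k"
      by (simp add: power_one_over)
    finally show ?thesis .
  qed
  have "summable (\<lambda>k. prob (E k))"
  proof (rule summable_comparison_test'[where N=1])
    show "summable (\<lambda>k. 48 * (1/2 :: real) ^ k)"
      by (intro summable_mult summable_geometric) simp
  qed (use prob_E in auto)
  then have "AE \<omega> in M. eventually (\<lambda>k. \<omega> \<in> space M - E k) sequentially"
    by (intro borel_cantelli_AE1) (auto simp: emeasure_eq_measure)
  then show ?thesis
    by eventually_elim (auto simp: E_def elim: eventually_mono)
qed

lemma AE_num_zeros_lower:
  assumes x: "\<And>k \<omega>. x \<omega> (Suc k) = \<xi> k \<omega>"
  shows "AE \<omega> in M. \<exists>c>0. \<exists>C. eventually (\<lambda>T. ereal (c * (sqrt (ln (1 / (T - 1/2))) / 2 - 1) - C)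
      \<le> num_zeros_from (dirichlet_series (x \<omega>)) T) (at_right (1/2))"
  using AE_sqrt_cancellation AE_many_sign_changes AE_block_remainder
proof eventually_elim
  case (elim \<omega>)
  let ?c = "std_normal_upper_tail\<^sup>2 / 2"
  let ?F = "\<lambda>k. Re (dirichlet_ext (\<lambda>k. x \<omega> (Suc k)) (of_real (1/2 + block_gap k)))"
  have sq: "sqrt_cancellation (\<lambda>k. x \<omega> (Suc k))"
    using elim(1) by (simp add: x)
  obtain n0 where n0: "\<And>n. n \<ge> n0 \<Longrightarrow> real (card {i. i < n \<and> sign_change i \<omega>}) > ?c * real n"
    using elim(2) by (auto simp: eventually_sequentially)
  obtain k0 where k0: "\<And>k. k \<ge> k0 \<Longrightarrow> \<not> eventually (\<lambda>n. sqrt (block_variance k) <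
      \<bar>\<Sum>m<n. (if m \<in> block k then 0 else block_weight k m) * \<xi> m \<omega>\<bar>) sequentially"
    using elim(3) unfolding eventually_sequentially[of "\<lambda>k. \<not> _ k"] by blast
  have close: "\<bar>?F k - block_sum k \<omega>\<bar> \<le> sqrt (block_variance k)" if "k \<ge> k0" for k
    using dirichlet_ext_minus_block[OF elim(1) k0[OF that]] by (simp add: x block_sum_def)
  show ?case
  proof (intro exI conjI)
    show "?c > 0"
      using std_normal_upper_tail_pos by simp
    show "eventually (\<lambda>T. ereal (?c * (sqrt (ln (1 / (T - 1/2))) / 2 - 1) - real k0)
      \<le> num_zeros_from (dirichlet_series (x \<omega>)) T) (at_right (1/2))"
    proof (rule num_zeros_lower[OF sq \<open>?c > 0\<close>])
      fix n assume "n \<ge> n0"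
      let ?G = "{i. i < n \<and> sign_change i \<omega>}"
      \<comment> \<open>For \<open>i \<ge> k0\<close> both blocks of the pair have index at least
        \<open>k0\<close>, so the remainder bound is available; at most \<open>k0\<close> sign
        changes are lost.\<close>
      let ?I = "?G - {..<k0}"
      have "real (card ?G) \<le> real (card ?I) + real (card {..<k0})"
        using diff_card_le_card_Diff[of "{..<k0}" ?G] by simp
      then have "real (card ?I) \<ge> ?c * real n - real k0"
        using n0[OF \<open>n \<ge> n0\<close>] by simp
      moreover have "i < n \<and> ?F (2 * i + 1) > 0 \<and> ?F (2 * i + 2) < 0" if "i \<in> ?I" for i
        using that close[of "2 * i + 1"] close[of "2 * i + 2"] by (auto simp: sign_change_def)
      ultimately show "\<exists>I. real (card I) \<ge> ?c * real n - real k0 \<and>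
          (\<forall>i\<in>I. i < n \<and> ?F (2 * i + 1) > 0 \<and> ?F (2 * i + 2) < 0)"
        by blast
    qed
  qed
qed

end

section \<open>Passage to the upper and lower limits\<close>

theorem theorem1p5:
  fixes M :: "'a measure" and X :: "nat \<Rightarrow> 'a \<Rightarrow> real"
  defines "N \<equiv> (\<lambda>\<omega> T. num_zeros_from (dirichlet_series (\<lambda>n. X n \<omega>)) T)"
  assumes "prob_space M"
    and "prob_space.indep_vars M (\<lambda>_. borel) X {1..}"
    and "\<And>n. n \<ge> 1 \<Longrightarrow> distributed M lborel (X n) (\<lambda>x. ennreal (std_normal_density x))"
  shows "(AE \<omega> in M.
            Limsup (at_right (1/2))
              (\<lambda>T. N \<omega> T / ereal (ln (1 / (T - 1/2)) * ln (ln (1 / (T - 1/2))))) < \<infinity>)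
       \<and> (\<forall>\<epsilon>>0. AE \<omega> in M.
            Liminf (at_right (1/2))
              (\<lambda>T. N \<omega> T / ereal (ln (1 / (T - 1/2)) powr (1/2 - \<epsilon>))) = \<infinity>)"
proof -
  interpret prob_space M
    by fact
  interpret iid_normal M "\<lambda>k. X (Suc k)"
  proof
    \<comment> \<open>Grouping into the singletons \<open>{Suc j}\<close> shifts the independent
      family from indices at least 1 to all natural numbers.\<close>
    have "indep_vars (\<lambda>j. PiM {Suc j} (\<lambda>_. borel)) (\<lambda>j \<omega>. restrict (\<lambda>i. X i \<omega>) {Suc j}) UNIV"
      by (intro indep_vars_restrict[OF assms(3)]) (auto simp: disjoint_family_on_def)
    then have "indep_vars (\<lambda>_. borel) (\<lambda>j \<omega>. (\<lambda>f. f (Suc j)) (restrict (\<lambda>i. X i \<omega>) {Suc j})) UNIV"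
      by (rule indep_vars_compose2) measurable
    then show "indep_vars (\<lambda>_. borel) (\<lambda>k. X (Suc k)) UNIV"
      by simp
  qed (use assms(4) in auto)
  let ?L = "\<lambda>T::real. ln (1 / (T - 1/2))"
  show ?thesis
  proof (intro conjI allI impI)
    have "AE \<omega> in M. \<exists>C. eventually (\<lambda>T. N \<omega> T \<le> ereal (C * (?L T * ln (?L T)))) (at_right (1/2))"
      unfolding N_def by (rule AE_num_zeros_upper) simp
    then show "AE \<omega> in M. Limsup (at_right (1/2)) (\<lambda>T. N \<omega> T / ereal (?L T * ln (?L T))) < \<infinity>"
    proof eventually_elim
      case (elim \<omega>)
      then obtain C where C: "eventually (\<lambda>T. N \<omega> T \<le> ereal (C * (?L T * ln (?L T)))) (at_right (1/2))"
        by blast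
      have "eventually (\<lambda>T. ?L T * ln (?L T) > 0) (at_right (1/2 :: real))"
        by real_asymp
      with C have "eventually (\<lambda>T. N \<omega> T / ereal (?L T * ln (?L T)) \<le> ereal C) (at_right (1/2))"
      proof eventually_elim
        case (elim T)
        then show ?case
          by (simp add: ereal_divide_le_pos mult.commute)
      qed
      then have "Limsup (at_right (1/2)) (\<lambda>T. N \<omega> T / ereal (?L T * ln (?L T))) \<le> ereal C"
        by (rule Limsup_bounded)
      then show ?case
        by (rule le_less_trans) simp
    qed
  next
    fix \<epsilon> :: real assume "\<epsilon> > 0"
    have "AE \<omega> in M. \<exists>c>0. \<exists>C. eventually (\<lambda>T. ereal (c * (sqrt (?L T) / 2 - 1) - C) \<le> N \<omega> T) (at_right (1/2))"
      unfolding N_def by (rule AE_num_zeros_lower) simp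
    then show "AE \<omega> in M. Liminf (at_right (1/2)) (\<lambda>T. N \<omega> T / ereal (?L T powr (1/2 - \<epsilon>))) = \<infinity>"
    proof eventually_elim
      case (elim \<omega>)
      then obtain c C where "c > 0"
        and C: "eventually (\<lambda>T. ereal (c * (sqrt (?L T) / 2 - 1) - C) \<le> N \<omega> T) (at_right (1/2))"
        by blast
      have L: "filterlim ?L at_top (at_right (1/2))"
        by real_asymp
      \<comment> \<open>The quotient grows like a positive multiple of y^\<epsilon>, so it
        eventually exceeds every real \<open>B\<close>.\<close>
      have lim: "filterlim (\<lambda>y. (c * (sqrt y / 2 - 1) - C) / y powr (1/2 - \<epsilon>)) at_top at_top"
        using \<open>c > 0\<close> \<open>\<epsilon> > 0\<close> by real_asymp
      have "ereal B \<le> Liminf (at_right (1/2)) (\<lambda>T. N \<omega> T / ereal (?L T powr (1/2 - \<epsilon>)))" for B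
      proof (rule Liminf_bounded)
        have "eventually (\<lambda>y. B \<le> (c * (sqrt y / 2 - 1) - C) / y powr (1/2 - \<epsilon>)) at_top"
          using lim by (simp add: filterlim_at_top)
        then have "eventually (\<lambda>y. B \<le> (c * (sqrt y / 2 - 1) - C) / y powr (1/2 - \<epsilon>) \<and> y > 0) at_top"
          by (intro eventually_conj eventually_gt_at_top)
        from eventually_compose_filterlim[OF this L] C
        show "eventually (\<lambda>T. ereal B \<le> N \<omega> T / ereal (?L T powr (1/2 - \<epsilon>))) (at_right (1/2))"
        proof eventually_elim
          case (elim T)
          have pos: "?L T powr (1/2 - \<epsilon>) > 0"
            using elim(1) by simp
          have "B * ?L T powr (1/2 - \<epsilon>) \<le> c * (sqrt (?L T) / 2 - 1) - C"
            using elim(1) pos_le_divide_eq[OF pos] by blast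
          then have "ereal (B * ?L T powr (1/2 - \<epsilon>)) \<le> N \<omega> T"
            using elim(2) order_trans ereal_less_eq(3) by blast
          then show ?case
            using pos by (simp add: ereal_le_divide_pos mult.commute)
        qed
      qed
      then show ?case
        using ereal_top by blast
    qed
  qed
qed

end
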